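(* For any transcendental real number $\zeta$, \[\frac{(\overline{w}(\zeta)+1)^2}{4\overline{w}(\zeta)}\le\overline{\lambda}(\zeta),\qquad \frac{(\underline{w}(\zeta)+1)^2}{4\underline{w}(\zeta)}\le\underline{\lambda}(\zeta).\] In particular, every $T$-number $\zeta$ satisfies $\limsup_{n\to\infty}n\lambda_n(\zeta)=\infty$.
   Context: $H(P)$ is the maximum modulus of the coefficients of $P\in\mathbb{Z}[T]$. $w_n(\zeta)$: supremum of $w$ such that $0<|P(\zeta)|\le H(P)^{-w}$ has infinitely many solutions $P\in\mathbb{Z}[T]$ of degree $\le n$. $\lambda_n(\zeta)$: supremum of $\lambda$ such that $1\le|x|\le X$, $\max_{1\le i\le n}|\zeta^ix-y_i|\le X^{-\lambda}$ has an integer solution for arbitrarily large $X$. $\overline{w}(\zeta)=\limsup w_n(\zeta)/n$, $\underline{w}(\zeta)=\liminf w_n(\zeta)/n$, $\overline{\lambda}(\zeta)=\limsup n\lambda_n(\zeta)$, $\underline{\lambda}(\zeta)=\liminf n\lambda_n(\zeta)$. A $T$-number is a $\zeta$ with $w_n(\zeta)<\infty$ for all $n$ and $\limsup w_n(\zeta)/n=\infty$. Values are in the extended reals. *)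

theory Defs
  imports Complex_Main "HOL-Library.Extended_Real" "HOL-Computational_Algebra.Polynomial"
begin

definition height :: "int poly \<Rightarrow> int" where
  "height P = Max ((\<lambda>i. \<bar>coeff P i\<bar>) ` {..degree P})"

definition w_exp :: "nat \<Rightarrow> real \<Rightarrow> ereal" where
  "w_exp n \<zeta> = Sup {ereal w | w :: real.
     infinite {P :: int poly. degree P \<le> n \<and> 0 < \<bar>poly (map_poly real_of_int P) \<zeta>\<bar> \<and>
                 \<bar>poly (map_poly real_of_int P) \<zeta>\<bar> \<le> real_of_int (height P) powr (- w)}}"

definition lambda_exp :: "nat \<Rightarrow> real \<Rightarrow> ereal" where
  "lambda_exp n \<zeta> = Sup {ereal l | l :: real.
     \<exists>\<^sub>F X :: real in at_top. \<exists>(x :: int) (y :: nat \<Rightarrow> int).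
       1 \<le> \<bar>x\<bar> \<and> real_of_int \<bar>x\<bar> \<le> X \<and>
       (\<forall>i\<in>{1..n}. \<bar>\<zeta> ^ i * real_of_int x - real_of_int (y i)\<bar> \<le> X powr (- l))}"

definition w_upper :: "real \<Rightarrow> ereal" where
  "w_upper \<zeta> = limsup (\<lambda>n. w_exp n \<zeta> / ereal (real n))"

definition w_lower :: "real \<Rightarrow> ereal" where
  "w_lower \<zeta> = liminf (\<lambda>n. w_exp n \<zeta> / ereal (real n))"

definition lambda_upper :: "real \<Rightarrow> ereal" where
  "lambda_upper \<zeta> = limsup (\<lambda>n. ereal (real n) * lambda_exp n \<zeta>)"

definition lambda_lower :: "real \<Rightarrow> ereal" where
  "lambda_lower \<zeta> = liminf (\<lambda>n. ereal (real n) * lambda_exp n \<zeta>)"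

definition T_number :: "real \<Rightarrow> bool" where
  "T_number \<zeta> \<longleftrightarrow> (\<forall>n. w_exp n \<zeta> < \<infinity>) \<and> limsup (\<lambda>n. w_exp n \<zeta> / ereal (real n)) = \<infinity>"

text \<open>
  The expression \<open>(w + 1)\<^sup>2 / (4 w)\<close>, extended to \<open>w = \<infinity>\<close> by its limit \<open>\<infinity>\<close>.
  The case distinction is needed because \<open>\<infinity> / \<infinity> = 0\<close> in type \<open>ereal\<close>.
\<close>

definition spectrum_bound :: "ereal \<Rightarrow> ereal" where
  "spectrum_bound w = (if w = \<infinity> then \<infinity> else (w + 1)\<^sup>2 / (4 * w))"

end

theory Submission
  imports Defs "HOL-Real_Asymp.Real_Asymp" "HOL-Library.FuncSet"
begin

text \<open>
  A polynomial \<open>P\<close> of degree at most \<open>n\<close> and height \<open>H\<close> with \<open>\<bar>P(\<zeta>)\<bar> \<le> H powr (- w)\<close> yields, for every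
  \<open>N \<ge> n\<close>, good simultaneous approximations to \<open>\<zeta>, \<dots>, \<zeta> ^ N\<close>: one looks for them among the integer
  sequences satisfying the linear recurrence with characteristic polynomial \<open>P\<close>. If the leading
  coefficient of the recurrence is comparable to \<open>H\<close>, only the first \<open>n\<close> terms have to be controlled,
  and the pigeonhole principle, applied to fractional parts and to the residues obstructing
  integrality, produces \<open>x\<close> of size \<open>H powr \<xi>\<close> with errors of size \<open>H powr (- \<beta>)\<close>, where
  \<open>\<xi> = (w (n - 1) + N) / n\<close> and \<open>\<beta> = (w + n - N) / n\<close>. Replacing \<open>\<zeta>\<close> by \<open>1 / (\<zeta> - a)\<close>, which makes
  \<open>P(a)\<close> the leading coefficient, reduces to this case. Hence
  \<open>\<lambda>\<^sub>N \<ge> (w\<^sub>n + n - N) / (w\<^sub>n (n - 1) + N)\<close>. With \<open>w\<^sub>n\<close> close to \<open>w n\<close> and \<open>N\<close> close to \<open>t n\<close>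
  this gives \<open>N \<lambda>\<^sub>N \<ge> t (w + 1 - t) / w\<close> in the limit, and \<open>t = (w + 1) / 2 \<ge> 1\<close> is optimal.
\<close>

section \<open>Integer solutions of a linear recurrence close to a geometric progression\<close>

text \<open>
  The first \<open>n\<close> terms round the geometric progression \<open>x \<eta> ^ i\<close>; the later ones make the defect
  \<open>\<Sum>k\<le>n. q k * v (i - k)\<close> of the recurrence a residue modulo \<open>q 0\<close>, so that two starting values
  with equal residues differ by an exact solution.
\<close>

function rounded_recurrence :: "nat \<Rightarrow> (nat \<Rightarrow> int) \<Rightarrow> real \<Rightarrow> int \<Rightarrow> nat \<Rightarrow> int" where
  "rounded_recurrence n q \<eta> x i =
     (if i < n then \<lfloor>\<eta> ^ i * of_int x\<rfloor>
      else - ((\<Sum>k\<in>{1..n}. q k * rounded_recurrence n q \<eta> x (i - k)) div q 0))"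
  by auto
termination
  by (relation "measure (\<lambda>(n, q, \<eta>, x, i). i)") auto

declare rounded_recurrence.simps [simp del]

lemma card_residues_le:
  fixes m :: int
  assumes "m \<noteq> 0"
  shows "finite (range (\<lambda>s. s mod m))" "card (range (\<lambda>s. s mod m)) \<le> nat \<bar>m\<bar>"
proof -
  \<comment> \<open>\<open>mod\<close> takes the sign of the divisor, so residues modulo a negative
    \<open>m\<close> lie in \<open>{m<..0}\<close>.\<close>
  have sub: "range (\<lambda>s. s mod m) \<subseteq> (if m > 0 then {0..<m} else {m<..0})"
    using assms by (auto simp: not_less intro: neg_mod_bound)
  show "finite (range (\<lambda>s. s mod m))"
    by (rule finite_subset[OF sub]) auto
  have "card (range (\<lambda>s. s mod m)) \<le> card (if m > 0 then {0..<m} else {m<..0})"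
    by (rule card_mono[OF _ sub]) auto
  then show "card (range (\<lambda>s. s mod m)) \<le> nat \<bar>m\<bar>"
    by (auto split: if_splits)
qed

text \<open>Pigeonhole over starting values: each \<open>x\<close> is recorded by the cells of width
  \<open>1 / B\<close> containing the fractional parts of \<open>\<eta> ^ i * x\<close> for
  \<open>1 \<le> i < n\<close>, and by the \<open>N - n + 1\<close> residues modulo
  \<open>q 0\<close>. The term \<open>i = 0\<close> needs no cell, since \<open>x\<close> is an
  integer; this explains the exponent \<open>n - 1\<close> of \<open>B\<close>. The difference of
  the sequences of two colliding starting values is the desired \<open>v\<close>.\<close>

lemma recurrence_approximation:
  fixes q :: "nat \<Rightarrow> int" and \<eta> :: real and B n N :: nat
  assumes n: "1 \<le> n" "n \<le> N" and q0: "q 0 \<noteq> 0" and B: "1 \<le> B"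
  obtains v :: "nat \<Rightarrow> int" where
    "v 0 \<noteq> 0" "\<bar>v 0\<bar> \<le> int B ^ (n - 1) * \<bar>q 0\<bar> ^ (N - n + 1)"
    "\<And>i. i < n \<Longrightarrow> \<bar>of_int (v i) - of_int (v 0) * \<eta> ^ i\<bar> \<le> 1 / real B"
    "\<And>i. i \<in> {n..N} \<Longrightarrow> (\<Sum>k\<le>n. q k * v (i - k)) = 0"
proof -
  define V where "V = rounded_recurrence n q \<eta>"
  define S where "S = (\<lambda>x i. \<Sum>k\<in>{1..n}. q k * V x (i - k))"
  define R where "R = range (\<lambda>s. s mod q 0)"
  \<comment> \<open>An upper bound for the number of pigeonholes; the \<open>M + 1\<close> starting
    values \<open>0, ..., M\<close> therefore collide.\<close>
  define M where "M = B ^ (n - 1) * nat \<bar>q 0\<bar> ^ (N - n + 1)"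
  define f where "f = (\<lambda>x::int. (restrict (\<lambda>i. \<lfloor>real B * frac (\<eta> ^ i * of_int x)\<rfloor>) {1..<n},
                            restrict (\<lambda>i. S x i mod q 0) {n..N}))"
  define D where "D = (PiE {1..<n} (\<lambda>_. {0..<int B})) \<times> (PiE {n..N} (\<lambda>_. R))"
  have R: "finite R" "card R \<le> nat \<bar>q 0\<bar>"
    unfolding R_def using card_residues_le[OF q0] by auto
  have fD: "f ` {0..int M} \<subseteq> D"
  proof (rule image_subsetI)
    fix x
    have "\<lfloor>real B * frac (\<eta> ^ i * of_int x)\<rfloor> \<in> {0..<int B}" for i
    proof -
      have "real B * frac (\<eta> ^ i * of_int x) < real B * 1"
        using frac_lt_1[of "\<eta> ^ i * of_int x"] B by (intro mult_strict_left_mono) auto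
      then show ?thesis
        using frac_ge_0[of "\<eta> ^ i * of_int x"] by (auto simp: floor_less_iff)
    qed
    then show "f x \<in> D"
      unfolding f_def D_def R_def by (intro SigmaI restrict_PiE_iff[THEN iffD2]) auto
  qed
  have finD: "finite D"
    unfolding D_def using R by (intro finite_cartesian_product finite_PiE) auto
  have "card D = B ^ (n - 1) * card R ^ (N - n + 1)"
    unfolding D_def using n by (simp add: card_cartesian_product card_PiE Suc_diff_le)
  also have "\<dots> \<le> M"
    unfolding M_def using R by (intro mult_left_mono power_mono) auto
  also have "M < card {0..int M}" by simp
  finally have "card D < card {0..int M}" .
  then have "\<not> inj_on f {0..int M}"
    using card_inj_on_le[OF _ fD finD] by (meson not_le)
  then obtain x y where xy: "x \<in> {0..int M}" "y \<in> {0..int M}" "x \<noteq> y" "f x = f y"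
    by (auto simp: inj_on_def)
  have f1: "\<lfloor>real B * frac (\<eta> ^ i * of_int x)\<rfloor> = \<lfloor>real B * frac (\<eta> ^ i * of_int y)\<rfloor>"
    if "i \<in> {1..<n}" for i
    using fun_cong[OF arg_cong[of _ _ fst, OF xy(4)], of i] that by (simp add: f_def)
  have f2: "S x i mod q 0 = S y i mod q 0" if "i \<in> {n..N}" for i
    using fun_cong[OF arg_cong[of _ _ snd, OF xy(4)], of i] that by (simp add: f_def)
  define v where "v = (\<lambda>i. V x i - V y i)"
  have V_less: "V x i = \<lfloor>\<eta> ^ i * of_int x\<rfloor>" if "i < n" for x i
    using that by (simp add: V_def rounded_recurrence.simps)
  have V_ge: "(\<Sum>k\<le>n. q k * V x (i - k)) = S x i mod q 0" if "i \<in> {n..N}" for x i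
  proof -
    have "V x i = - (S x i div q 0)"
      using that unfolding V_def S_def by (subst rounded_recurrence.simps) auto
    moreover have "(\<Sum>k\<le>n. q k * V x (i - k)) = q 0 * V x i + S x i"
      unfolding S_def by (simp add: atMost_atLeast0 sum.atLeast_Suc_atMost)
    ultimately show ?thesis
      by (simp add: minus_mult_div_eq_mod[symmetric])
  qed
  have v0: "v 0 = x - y" using n V_less[of 0] by (simp add: v_def)
  show thesis
  proof (rule that[of v])
    show "v 0 \<noteq> 0" using xy v0 by simp
    have "\<bar>v 0\<bar> \<le> int M" using xy v0 by auto
    then show "\<bar>v 0\<bar> \<le> int B ^ (n - 1) * \<bar>q 0\<bar> ^ (N - n + 1)"
      by (simp add: M_def)
  next
    fix i assume i: "i < n"
    show "\<bar>of_int (v i) - of_int (v 0) * \<eta> ^ i\<bar> \<le> 1 / real B"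
    proof (cases "i = 0")
      case False
      let ?a = "frac (\<eta> ^ i * of_int x)" and ?b = "frac (\<eta> ^ i * of_int y)"
      have "\<bar>real B * ?a - real B * ?b\<bar> < 1"
        using f1[of i] i False by (simp add: abs_less_iff) linarith
      then have "real B * \<bar>?a - ?b\<bar> < 1"
        using B by (simp add: right_diff_distrib[symmetric] abs_mult)
      \<comment> \<open>Since \<open>v i\<close> is a difference of two floors, its error is a
        difference of two fractional parts, which lie in the same cell.\<close>
      moreover have "of_int (v i) - of_int (v 0) * \<eta> ^ i = ?b - ?a"
        using i by (simp add: v_def V_less frac_def v0[unfolded v_def] algebra_simps)
      ultimately show ?thesis
        using B by (simp add: pos_le_divide_eq mult.commute abs_minus_commute)
    qed (use B in simp)
  next
    fix i assume "i \<in> {n..N}"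
    then show "(\<Sum>k\<le>n. q k * v (i - k)) = 0"
      using V_ge[of i x] V_ge[of i y] f2[of i]
      by (simp add: v_def right_diff_distrib sum_subtractf)
  qed
qed

text \<open>The error \<open>v i - v 0 * \<eta> ^ i\<close> satisfies the same recurrence up to a
  defect, because \<open>\<eta>\<close> is only an approximate root of the characteristic
  polynomial. Solving for the newest error divides by \<open>q 0\<close>. In the growth factor per
  step, \<open>n * D\<close> accounts for the \<open>n\<close> preceding errors and \<open>1\<close>
  for the defect, which \<open>small\<close> bounds by \<open>E * \<bar>q 0\<bar>\<close>.\<close>

lemma recurrence_error_propagation:
  fixes q v :: "nat \<Rightarrow> real" and \<eta> D E :: real
  assumes q0: "q 0 \<noteq> 0" and D: "\<And>k. k \<le> n \<Longrightarrow> \<bar>q k\<bar> \<le> D * \<bar>q 0\<bar>" 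
    and init: "\<And>i. i < n \<Longrightarrow> \<bar>v i - v 0 * \<eta> ^ i\<bar> \<le> E"
    and rec: "\<And>i. i \<in> {n..N} \<Longrightarrow> (\<Sum>k\<le>n. q k * v (i - k)) = 0"
    and small: "\<And>i. i \<in> {n..N} \<Longrightarrow> \<bar>v 0 * \<eta> ^ (i - n) * (\<Sum>k\<le>n. q k * \<eta> ^ (n - k))\<bar> \<le> E * \<bar>q 0\<bar>"
    and n: "1 \<le> n" and i: "i \<le> N"
  shows "\<bar>v i - v 0 * \<eta> ^ i\<bar> \<le> E * (n * D + 1) ^ i"
  using i
proof (induction i rule: less_induct)
  case (less i)
  define e where "e = (\<lambda>i. v i - v 0 * \<eta> ^ i)"
  have D0: "0 \<le> D"
    using D[of 0] q0 by (simp add: mult_le_cancel_right1 )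
  have E0: "0 \<le> E" using init[of 0] n by auto
  have G1: "1 \<le> n * D + 1" using D0 by simp
  show ?case
  proof (cases "i < n")
    case True
    have "E * 1 \<le> E * (n * D + 1) ^ i"
      using E0 G1 by (intro mult_left_mono) auto
    with init[OF True] show ?thesis by simp
  next
    case False
    then have iN: "i \<in> {n..N}" using less by auto
    have "(\<Sum>k\<le>n. q k * e (i - k)) =
        (\<Sum>k\<le>n. q k * v (i - k)) - (\<Sum>k\<le>n. q k * (v 0 * \<eta> ^ (i - k)))"
      by (simp add: e_def right_diff_distrib sum_subtractf)
    \<comment> \<open>The contribution of the geometric progression is a multiple of the
      characteristic polynomial at \<open>\<eta>\<close>.\<close>
    also have "(\<Sum>k\<le>n. q k * (v 0 * \<eta> ^ (i - k))) = v 0 * \<eta> ^ (i - n) * (\<Sum>k\<le>n. q k * \<eta> ^ (n - k))"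
      unfolding sum_distrib_left
    proof (rule sum.cong)
      fix k assume "k \<in> {..n}"
      then have "i - k = (i - n) + (n - k)" using iN by auto
      then show "q k * (v 0 * \<eta> ^ (i - k)) = v 0 * \<eta> ^ (i - n) * (q k * \<eta> ^ (n - k))"
        by (simp add: power_add)
    qed simp
    finally have "\<bar>\<Sum>k\<le>n. q k * e (i - k)\<bar> \<le> E * \<bar>q 0\<bar>"
      using rec[OF iN] small[OF iN] by simp
    moreover have "(\<Sum>k\<le>n. q k * e (i - k)) = q 0 * e i + (\<Sum>k\<in>{1..n}. q k * e (i - k))"
      by (simp add: atMost_atLeast0 sum.atLeast_Suc_atMost)
    ultimately have "\<bar>q 0 * e i\<bar> \<le> E * \<bar>q 0\<bar> + \<bar>\<Sum>k\<in>{1..n}. q k * e (i - k)\<bar>"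
      by linarith
    also have "\<bar>\<Sum>k\<in>{1..n}. q k * e (i - k)\<bar> \<le> (\<Sum>k\<in>{1..n}. \<bar>q k * e (i - k)\<bar>)"
      by (rule sum_abs)
    also have "\<dots> \<le> (\<Sum>k\<in>{1..n}. D * \<bar>q 0\<bar> * (E * (n * D + 1) ^ (i - 1)))"
    proof (rule sum_mono)
      fix k assume k: "k \<in> {1..n}"
      have "\<bar>e (i - k)\<bar> \<le> E * (n * D + 1) ^ (i - k)"
        unfolding e_def using k iN less.prems by (intro less.IH) auto
      also have "\<dots> \<le> E * (n * D + 1) ^ (i - 1)"
        using E0 G1 k by (intro mult_left_mono power_increasing) auto
      finally show "\<bar>q k * e (i - k)\<bar> \<le> D * \<bar>q 0\<bar> * (E * (n * D + 1) ^ (i - 1))"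
        using D[of k] k D0 unfolding abs_mult by (intro mult_mono) auto
    qed
    also have "\<dots> = \<bar>q 0\<bar> * (n * D * (E * (n * D + 1) ^ (i - 1)))" by simp
    also have "E * \<bar>q 0\<bar> \<le> \<bar>q 0\<bar> * (E * (n * D + 1) ^ (i - 1))"
    proof -
      have "E * 1 \<le> E * (n * D + 1) ^ (i - 1)"
        using E0 G1 by (intro mult_left_mono) auto
      then show ?thesis by (subst mult.commute) (auto intro: mult_left_mono)
    qed
    finally have "\<bar>q 0\<bar> * \<bar>e i\<bar> \<le> \<bar>q 0\<bar> * (E * ((n * D + 1) ^ (i - 1) * (n * D + 1)))"
      by (simp add: abs_mult algebra_simps)
    then have "\<bar>e i\<bar> \<le> E * ((n * D + 1) ^ (i - 1) * (n * D + 1))"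
      using q0 mult_le_cancel_left_pos[of "\<bar>q 0\<bar>"] by simp
    also have "(n * D + 1) ^ (i - 1) * (n * D + 1) = (n * D + 1) ^ i"
      using iN n by (simp add: power_eq_if[of _ i])
    finally show ?thesis by (simp add: e_def)
  qed
qed

section \<open>Heights, values and translates of integer polynomials\<close>

lemma poly_of_int_conv_sum:
  assumes "degree P \<le> n"
  shows "poly (map_poly real_of_int P) x = (\<Sum>k\<le>n. of_int (coeff P k) * x ^ k)"
proof -
  have "degree (map_poly real_of_int P) = degree P" by (simp add: degree_map_poly)
  then show ?thesis
    unfolding poly_altdef using assms
    by (intro sum.mono_neutral_cong_left) (auto simp: coeff_map_poly coeff_eq_0)
qed

lemma abs_coeff_le_height: "\<bar>coeff P i\<bar> \<le> height P"
proof (cases "i \<le> degree P")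
  case True
  then show ?thesis unfolding height_def by (intro Max_ge) auto
next
  case False
  have "0 \<le> \<bar>coeff P 0\<bar>" by simp
  also have "\<bar>coeff P 0\<bar> \<le> height P" unfolding height_def by (intro Max_ge) auto
  finally show ?thesis using False by (simp add: coeff_eq_0)
qed

lemma height_le_iff: "height P \<le> M \<longleftrightarrow> (\<forall>i. \<bar>coeff P i\<bar> \<le> M)"
proof
  assume "\<forall>i. \<bar>coeff P i\<bar> \<le> M"
  then show "height P \<le> M" unfolding height_def by (subst Max_le_iff) auto
qed (use abs_coeff_le_height order_trans in blast)

lemma height_ge_1:
  assumes "P \<noteq> 0"
  shows "1 \<le> height P"
proof -
  have "1 \<le> \<bar>lead_coeff P\<bar>" using assms by (simp add: int_one_le_iff_zero_less)
  also have "\<dots> \<le> height P" by (rule abs_coeff_le_height)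
  finally show ?thesis .
qed

text \<open>A polynomial is determined by its coefficient vector, which here lies in a finite box.
  Consequently an infinite set of polynomials of bounded degree has unbounded heights.\<close>

lemma finite_bounded_height: "finite {P :: int poly. degree P \<le> n \<and> height P \<le> M}"
proof (rule finite_imageD)
  let ?S = "{P :: int poly. degree P \<le> n \<and> height P \<le> M}"
  let ?f = "\<lambda>P :: int poly. restrict (coeff P) {..n}"
  have "?f ` ?S \<subseteq> PiE {..n} (\<lambda>_. {-M..M})"
    by (auto simp: height_le_iff abs_le_iff minus_le_iff split: if_splits)
  then show "finite (?f ` ?S)"
    by (rule finite_subset) (auto intro: finite_PiE)
  show "inj_on ?f ?S"
  proof (rule inj_onI)
    fix P Q assume PQ: "P \<in> ?S" "Q \<in> ?S" "?f P = ?f Q"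
    show "P = Q"
    proof (rule poly_eqI)
      fix i
      show "coeff P i = coeff Q i"
        using fun_cong[OF PQ(3), of i] PQ(1,2) by (cases "i \<le> n") (auto simp: coeff_eq_0)
    qed
  qed
qed

text \<open>Interpolation with a constant depending only on the nodes: at one of
  \<open>n + 1\<close> fixed integers a polynomial of degree at most \<open>n\<close> has a value
  comparable to its height. The induction removes a node \<open>a\<close> by writing
  \<open>P - P(a)\<close> as \<open>(T - a) * Q\<close>.\<close>

lemma coeff_bound_from_values:
  fixes A :: "int set"
  assumes "card A = Suc n"
  shows "\<exists>C\<ge>0. \<forall>P M. degree P \<le> n \<longrightarrow> (\<forall>a\<in>A. \<bar>poly P a\<bar> \<le> M) \<longrightarrow> (\<forall>i. \<bar>coeff P i\<bar> \<le> C * M)"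
  using assms
proof (induction n arbitrary: A)
  case 0
  then obtain a where A: "A = {a}" by (auto simp: card_Suc_eq)
  have "\<bar>coeff P i\<bar> \<le> 1 * M" if P: "degree P \<le> 0" "\<forall>a\<in>A. \<bar>poly P a\<bar> \<le> M" for P M i
  proof -
    obtain c where c: "P = [:c:]" using P(1) by (auto elim: degree_eq_zeroE)
    then have "\<bar>c\<bar> \<le> M" using P(2) A by simp
    then show ?thesis unfolding c by (cases i) auto
  qed
  then show ?case by (intro exI[of _ 1]) auto
next
  case (Suc n)
  then obtain a A' where A: "A = insert a A'" "a \<notin> A'" "card A' = Suc n"
    using card_Suc_eq[THEN iffD1, OF Suc.prems] by metis
  obtain C where C: "C \<ge> 0"
    "\<And>P M i. degree P \<le> n \<Longrightarrow> (\<forall>a\<in>A'. \<bar>poly P a\<bar> \<le> M) \<Longrightarrow> \<bar>coeff P i\<bar> \<le> C * M"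
    using Suc.IH[OF A(3)] by metis
  have "\<bar>coeff P i\<bar> \<le> (1 + (\<bar>a\<bar> + 1) * (2 * C)) * M"
    if P: "degree P \<le> Suc n" "\<forall>a\<in>A. \<bar>poly P a\<bar> \<le> M" for P M i
  proof -
    have "poly (P - [:poly P a:]) a = 0" by simp
    then obtain Q where Q: "P - [:poly P a:] = [:-a, 1:] * Q"
      using poly_eq_0_iff_dvd by blast
    then have PQ: "P = [:poly P a:] + [:-a, 1:] * Q" by (metis diff_eq_eq add.commute)
    have degQ: "degree Q \<le> n"
    proof (cases "Q = 0")
      case False
      have "degree (P - [:poly P a:]) \<le> Suc n" using P by (intro degree_diff_le) auto
      moreover have "degree ([:-a, 1:] * Q) = 1 + degree Q"
        using False by (subst degree_mult_eq) auto
      ultimately show ?thesis using Q by simp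
    qed simp
    have M: "\<bar>poly P a\<bar> \<le> M" "0 \<le> M" using P(2) A by (auto intro: order_trans[OF abs_ge_zero])
    \<comment> \<open>Distinct integer nodes are at least 1 apart, so dividing by
      \<open>b - a\<close> does not enlarge the value.\<close>
    have "\<bar>poly Q b\<bar> \<le> 2 * M" if b: "b \<in> A'" for b
    proof -
      have "poly P b - poly P a = (b - a) * poly Q b"
        using arg_cong[OF Q, of "\<lambda>p. poly p b"] by (simp add: algebra_simps)
      then have "\<bar>b - a\<bar> * \<bar>poly Q b\<bar> = \<bar>poly P b - poly P a\<bar>" by (simp add: abs_mult)
      moreover have "\<bar>poly P b\<bar> \<le> M" using P(2) A b by auto
      moreover have "1 * \<bar>poly Q b\<bar> \<le> \<bar>b - a\<bar> * \<bar>poly Q b\<bar>"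
      proof (rule mult_right_mono)
        have "b \<noteq> a" using b A by auto
        then show "1 \<le> \<bar>b - a\<bar>" by linarith
      qed simp
      ultimately show ?thesis using M by linarith
    qed
    then have cQ: "\<bar>coeff Q i\<bar> \<le> C * (2 * M)" for i
      by (intro C(2)[OF degQ]) auto
    have "coeff P i = (if i = 0 then poly P a else 0) - a * coeff Q i + (if i = 0 then 0 else coeff Q (i - 1))"
      by (subst PQ) (auto simp: coeff_pCons split: nat.splits)
    then have "\<bar>coeff P i\<bar> \<le> M + \<bar>a * coeff Q i\<bar> + C * (2 * M)"
      using M cQ[of "i - 1"] C(1) by (auto split: if_splits)
    also have "\<bar>a * coeff Q i\<bar> \<le> \<bar>a\<bar> * (C * (2 * M))"
      unfolding abs_mult using cQ[of i] by (intro mult_left_mono) auto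
    finally show ?thesis by (simp add: algebra_simps)
  qed
  then show ?case using C(1) by (intro exI[of _ "1 + (\<bar>a\<bar> + 1) * (2 * C)"]) auto
qed

text \<open>Translation by \<open>a\<close> is linear on polynomials of degree at most
  \<open>n\<close>, hence bounded in the coefficient norm. The induction peels off the constant
  coefficient as in Horner's scheme.\<close>

lemma coeff_shift_bound:
  fixes a :: int
  shows "\<exists>D\<ge>1. \<forall>P M. degree P \<le> n \<longrightarrow> (\<forall>i. \<bar>coeff P i\<bar> \<le> M) \<longrightarrow> (\<forall>k. \<bar>coeff (pcompose P [:a, 1:]) k\<bar> \<le> D * M)"
proof (induction n)
  case 0
  show ?case by (intro exI[of _ 1]) (auto elim!: degree_eq_zeroE)
next
  case (Suc n)
  then obtain D where D: "D \<ge> 1"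
    "\<And>P M k. degree P \<le> n \<Longrightarrow> (\<forall>i. \<bar>coeff P i\<bar> \<le> M) \<Longrightarrow> \<bar>coeff (pcompose P [:a, 1:]) k\<bar> \<le> D * M"
    by metis
  have "\<bar>coeff (pcompose P [:a, 1:]) k\<bar> \<le> (1 + (\<bar>a\<bar> + 1) * D) * M"
    if P: "degree P \<le> Suc n" "\<forall>i. \<bar>coeff P i\<bar> \<le> M" for P M k
  proof -
    obtain c Q where PQ: "P = pCons c Q" by (cases P) auto
    have degQ: "degree Q \<le> n" using P(1) PQ by (cases "Q = 0") auto
    have c: "\<bar>c\<bar> \<le> M" using P(2)[rule_format, of 0] PQ by simp
    have "\<forall>i. \<bar>coeff Q i\<bar> \<le> M"
    proof
      fix i show "\<bar>coeff Q i\<bar> \<le> M" using P(2)[rule_format, of "Suc i"] PQ by simp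
    qed
    then have cQ: "\<bar>coeff (pcompose Q [:a, 1:]) k\<bar> \<le> D * M" for k
      by (intro D(2)[OF degQ])
    let ?R = "pcompose Q [:a, 1:]"
    have "coeff (pcompose P [:a, 1:]) k = (if k = 0 then c else 0) + a * coeff ?R k + (if k = 0 then 0 else coeff ?R (k - 1))"
      by (auto simp: PQ pcompose_pCons coeff_pCons split: nat.splits)
    then have "\<bar>coeff (pcompose P [:a, 1:]) k\<bar> \<le> M + \<bar>a * coeff ?R k\<bar> + D * M"
      using c cQ[of "k - 1"] by (auto split: if_splits)
    also have "\<bar>a * coeff ?R k\<bar> \<le> \<bar>a\<bar> * (D * M)"
      unfolding abs_mult using cQ[of k] by (intro mult_left_mono) auto
    finally show ?thesis by (simp add: algebra_simps)
  qed
  then show ?case using D(1) by (intro exI[of _ "1 + (\<bar>a\<bar> + 1) * D"]) auto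
qed

lemma poly_of_int_add:
  "poly (map_poly real_of_int (p + q)) x = poly (map_poly real_of_int p) x + poly (map_poly real_of_int q) x"
proof -
  have "map_poly real_of_int (p + q) = map_poly real_of_int p + map_poly real_of_int q"
    by (rule poly_eqI) (simp add: coeff_map_poly)
  then show ?thesis by simp
qed

lemma poly_of_int_shift:
  "poly (map_poly real_of_int (pcompose P [:a, 1:])) y = poly (map_poly real_of_int P) (y + of_int a)"
proof (induction P)
  case (pCons c Q)
  have "pcompose (pCons c Q) [:a, 1:] = [:c:] + (smult a (pcompose Q [:a, 1:]) + pCons 0 (pcompose Q [:a, 1:]))"
    by (simp add: pcompose_pCons)
  then show ?case
    by (simp add: poly_of_int_add map_poly_pCons map_poly_smult pCons.IH algebra_simps)
qed simp

section \<open>From small polynomial values to simultaneous approximations\<close>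

text \<open>The recurrence is built from the coefficients \<open>q\<close> of
  \<open>P(T + a)\<close>, so that \<open>q 0 = P(a)\<close> is comparable to the height. Its
  solution \<open>v\<close> follows powers of \<open>\<eta> = 1 / (\<zeta> - a)\<close>; read
  backwards from index \<open>N\<close>, it follows powers of \<open>\<zeta> - a\<close>, and the
  binomial theorem leads to powers of \<open>\<zeta>\<close>. The number \<open>B\<close> of
  subdivisions is left free, to be balanced against the height later.\<close>

lemma simultaneous_approximation_from_polynomial:
  fixes \<zeta> C :: real and a :: int and n N :: nat
  assumes n: "1 \<le> n" "n \<le> N" and a: "\<zeta> \<noteq> of_int a" and C: "0 < C"
  obtains K :: real where "1 \<le> K"
    "\<And>P B \<epsilon>. degree P \<le> n \<Longrightarrow> P \<noteq> 0 \<Longrightarrow> of_int (height P) \<le> C * \<bar>of_int (poly P a)\<bar> \<Longrightarrow> 1 \<le> B \<Longrightarrow>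
      \<epsilon> = K * (1 / real B + real B ^ (n - 1) * of_int (height P) ^ (N - n) * \<bar>poly (map_poly real_of_int P) \<zeta>\<bar>) \<Longrightarrow>
      \<epsilon> < 1 \<Longrightarrow>
      \<exists>(x::int) (y::nat \<Rightarrow> int). 1 \<le> \<bar>x\<bar> \<and>
        of_int \<bar>x\<bar> \<le> K * (real B ^ (n - 1) * of_int (height P) ^ (N - n + 1)) \<and>
        (\<forall>i\<in>{1..N}. \<bar>\<zeta> ^ i * of_int x - of_int (y i)\<bar> \<le> \<epsilon>)"
proof -
  obtain D0 :: int where D0: "D0 \<ge> 1"
    "\<And>P M k. degree P \<le> n \<Longrightarrow> (\<forall>i. \<bar>coeff P i\<bar> \<le> M) \<Longrightarrow> \<bar>coeff (pcompose P [:a, 1:]) k\<bar> \<le> D0 * M"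
    using coeff_shift_bound[of n a] by metis
  define D where "D = real_of_int D0"
  have D: "1 \<le> D" using D0 by (simp add: D_def)
  define \<theta> where "\<theta> = \<zeta> - of_int a"
  have \<theta>: "\<theta> \<noteq> 0" using a by (simp add: \<theta>_def)
  define \<eta> where "\<eta> = 1 / \<theta>"
  \<comment> \<open>\<open>W\<close> covers the powers of \<open>D\<close> and \<open>\<eta>\<close>
    in the defect, \<open>G\<close> is the growth factor of the recurrence and \<open>L\<close>
    comes from the binomial expansion. \<open>K1\<close> collects the constants in the error,
    \<open>K2\<close> those in the size of \<open>x\<close>.\<close>
  define W where "W = D ^ (N - n) * (\<bar>\<eta>\<bar> + 1) ^ N"
  define G where "G = real n * (D * C) + 1"
  define L where "L = (\<bar>of_int a\<bar> + (1 + \<bar>\<theta>\<bar>)) ^ N"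
  define K1 where "K1 = 2 * L * (W * G ^ N)"
  define K2 where "K2 = 2 * D ^ (N - n + 1) * (\<bar>\<eta>\<bar> + 1) ^ N"
  define K where "K = K1 + K2"
  have W1: "1 \<le> W" unfolding W_def using D by (auto intro!: mult_ge1_I one_le_power)
  have G1: "1 \<le> G" using D C by (simp add: G_def)
  have L1: "1 \<le> L" unfolding L_def by (intro one_le_power) simp
  have WG1: "1 \<le> W * G ^ N" using W1 G1 by (auto intro!: mult_ge1_I one_le_power)
  have K1_1: "1 \<le> K1"
    unfolding K1_def by (intro mult_ge1_I[OF mult_ge1_I]) (use L1 WG1 in auto)
  have K2_1: "1 \<le> K2"
    unfolding K2_def using D by (intro mult_ge1_I one_le_power) auto
  show thesis
  proof (rule that[of K])
    show "1 \<le> K" using K1_1 K2_1 by (simp add: K_def)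
  next
    fix P B \<epsilon>
    assume P: "degree P \<le> n" "P \<noteq> 0" "of_int (height P) \<le> C * \<bar>of_int (poly P a)\<bar>" and B: "1 \<le> B"
      and \<epsilon>: "\<epsilon> = K * (1 / real B + real B ^ (n - 1) * of_int (height P) ^ (N - n) * \<bar>poly (map_poly real_of_int P) \<zeta>\<bar>)"
        "\<epsilon> < 1"
    define H where "H = real_of_int (height P)"
    have H1: "1 \<le> H" using height_ge_1[OF P(2)] by (simp add: H_def)
    define E where "E = 1 / real B + real B ^ (n - 1) * H ^ (N - n) * \<bar>poly (map_poly real_of_int P) \<zeta>\<bar>"
    have E0: "0 \<le> E" using H1 by (simp add: E_def)
    define q where "q = coeff (pcompose P [:a, 1:])"
    have q0: "q 0 = poly P a" by (simp add: q_def)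
    have q0nz: "q 0 \<noteq> 0" using P(3) H1 q0 by (auto simp: H_def)
    have qH: "\<bar>real_of_int (q k)\<bar> \<le> D * H" for k
      using D0(2)[OF P(1), of "height P" k] abs_coeff_le_height
      by (simp add: q_def D_def H_def flip: of_int_mult of_int_abs)
    have qD: "\<bar>real_of_int (q k)\<bar> \<le> D * C * \<bar>real_of_int (q 0)\<bar>" for k
    proof -
      have "D * H \<le> D * (C * \<bar>real_of_int (q 0)\<bar>)"
        using P(3) q0 D by (intro mult_left_mono) (auto simp: H_def)
      with qH[of k] show ?thesis by simp
    qed
    obtain v where v: "v 0 \<noteq> 0" "\<bar>v 0\<bar> \<le> int B ^ (n - 1) * \<bar>q 0\<bar> ^ (N - n + 1)"
      "\<And>i. i < n \<Longrightarrow> \<bar>of_int (v i) - of_int (v 0) * \<eta> ^ i\<bar> \<le> 1 / real B"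
      "\<And>i. i \<in> {n..N} \<Longrightarrow> (\<Sum>k\<le>n. q k * v (i - k)) = 0"
      using recurrence_approximation[where q = q and \<eta> = \<eta>, OF n q0nz B] by blast
    have v0: "\<bar>real_of_int (v 0)\<bar> \<le> real B ^ (n - 1) * \<bar>real_of_int (q 0)\<bar> ^ (N - n + 1)"
      using v(2) unfolding of_int_le_iff[where ?'a = real, symmetric] by simp
    have degq: "degree (pcompose P [:a, 1:]) \<le> n"
      using degree_pcompose_le[of P "[:a, 1:]"] P(1) by simp
    \<comment> \<open>The characteristic polynomial is \<open>P(T + a)\<close> with reversed
      coefficients, so its value at \<open>1 / \<theta>\<close> is \<open>P(\<zeta>)\<close> up to
      the factor \<open>\<eta> ^ n\<close>.\<close>
    have Peta: "(\<Sum>k\<le>n. of_int (q k) * \<eta> ^ (n - k)) = \<eta> ^ n * poly (map_poly real_of_int P) \<zeta>"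
    proof -
      have "poly (map_poly real_of_int P) \<zeta> = (\<Sum>k\<le>n. of_int (q k) * \<theta> ^ k)"
        using poly_of_int_shift[of P a \<theta>] poly_of_int_conv_sum[OF degq, of \<theta>]
        by (simp add: \<theta>_def q_def)
      moreover have "\<eta> ^ (n - k) = \<eta> ^ n * \<theta> ^ k" if "k \<le> n" for k
      proof -
        have "\<eta> ^ n = \<eta> ^ (n - k) * \<eta> ^ k" using that by (simp flip: power_add)
        then show ?thesis using \<theta> by (simp add: \<eta>_def field_simps)
      qed
      ultimately show ?thesis by (simp add: sum_distrib_left mult_ac)
    qed
    have err: "\<bar>of_int (v i) - of_int (v 0) * \<eta> ^ i\<bar> \<le> W * G ^ N * E" if i: "i \<le> N" for i
    proof -
      have "\<bar>of_int (v i) - of_int (v 0) * \<eta> ^ i\<bar> \<le> W * E * (real n * (D * C) + 1) ^ i"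
      proof (rule recurrence_error_propagation[where q = "\<lambda>k. of_int (q k)" and N = N])
        show "real_of_int (q 0) \<noteq> 0" using q0nz by simp
        show "\<bar>real_of_int (q k)\<bar> \<le> D * C * \<bar>real_of_int (q 0)\<bar>" for k by (rule qD)
        show "\<bar>of_int (v i) - of_int (v 0) * \<eta> ^ i\<bar> \<le> W * E" if "i < n" for i
        proof -
          have "1 / real B \<le> E" using H1 by (simp add: E_def)
          also have "1 * E \<le> W * E" using W1 E0 by (intro mult_right_mono) auto
          finally show ?thesis using v(3)[OF that] by simp
        qed
        show "(\<Sum>k\<le>n. real_of_int (q k) * of_int (v (i - k))) = 0" if "i \<in> {n..N}" for i
          using v(4)[OF that] by (simp flip: of_int_mult of_int_sum)
        show "\<bar>of_int (v 0) * \<eta> ^ (i - n) * (\<Sum>k\<le>n. of_int (q k) * \<eta> ^ (n - k))\<bar> \<le> W * E * \<bar>of_int (q 0)\<bar>"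
          if i: "i \<in> {n..N}" for i
        proof -
          let ?p = "\<bar>poly (map_poly real_of_int P) \<zeta>\<bar>" and ?q = "\<bar>real_of_int (q 0)\<bar>"
          have "\<eta> ^ (i - n) * \<eta> ^ n = \<eta> ^ i" using i by (simp flip: power_add)
          then have "of_int (v 0) * \<eta> ^ (i - n) * (\<Sum>k\<le>n. of_int (q k) * \<eta> ^ (n - k)) =
              of_int (v 0) * \<eta> ^ i * poly (map_poly real_of_int P) \<zeta>"
            by (simp add: Peta flip: mult.assoc)
          then have "\<bar>of_int (v 0) * \<eta> ^ (i - n) * (\<Sum>k\<le>n. of_int (q k) * \<eta> ^ (n - k))\<bar> =
              \<bar>of_int (v 0)\<bar> * \<bar>\<eta>\<bar> ^ i * ?p" by (simp only: abs_mult power_abs)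
          also have "\<dots> \<le> (real B ^ (n - 1) * ?q ^ (N - n + 1)) * (\<bar>\<eta>\<bar> + 1) ^ N * ?p"
          proof (intro mult_mono v0)
            have "\<bar>\<eta>\<bar> ^ i \<le> (\<bar>\<eta>\<bar> + 1) ^ i" by (intro power_mono) auto
            also have "\<dots> \<le> (\<bar>\<eta>\<bar> + 1) ^ N" using i by (intro power_increasing) auto
            finally show "\<bar>\<eta>\<bar> ^ i \<le> (\<bar>\<eta>\<bar> + 1) ^ N" .
          qed auto
          \<comment> \<open>One factor \<open>?q\<close> is kept for the right-hand side of the
            goal; the other \<open>N - n\<close> are estimated by \<open>D * H\<close>.\<close>
          also have "\<dots> = ?q ^ (N - n) * (real B ^ (n - 1) * (\<bar>\<eta>\<bar> + 1) ^ N * ?p * ?q)" by simp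
          also have "\<dots> \<le> (D * H) ^ (N - n) * (real B ^ (n - 1) * (\<bar>\<eta>\<bar> + 1) ^ N * ?p * ?q)"
            using qH[of 0] by (intro mult_right_mono power_mono) auto
          also have "\<dots> = W * (real B ^ (n - 1) * H ^ (N - n) * ?p) * ?q"
            by (simp add: W_def power_mult_distrib)
          also have "\<dots> \<le> W * E * ?q"
            using W1 by (intro mult_right_mono mult_left_mono) (auto simp: E_def)
          finally show ?thesis .
        qed
      qed (use n i in auto)
      also have "\<dots> \<le> W * E * G ^ N"
        unfolding G_def[symmetric] using W1 E0 G1 i by (intro mult_left_mono power_increasing) auto
      finally show ?thesis by (simp add: mult_ac)
    qed
    define F where "F = W * G ^ N * E"
    have F0: "0 \<le> F" using WG1 E0 by (simp add: F_def)
    have K1E: "2 * L * F \<le> \<epsilon>"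
    proof -
      have "2 * L * F = K1 * E" by (simp add: K1_def F_def)
      also have "\<dots> \<le> K * E" using K2_1 E0 by (intro mult_right_mono) (auto simp: K_def)
      finally show ?thesis by (simp add: \<epsilon>(1) E_def H_def)
    qed
    \<comment> \<open>\<open>v (N - k)\<close> approximates \<open>x * \<theta> ^ k\<close>;
      substituting it into the expansion of \<open>x * (\<theta> + a) ^ i\<close> gives the integer
      \<open>y i\<close>.\<close>
    define x where "x = v N"
    define y where "y = (\<lambda>i. \<Sum>k\<le>i. of_nat (i choose k) * v (N - k) * a ^ (i - k))"
    have uerr: "\<bar>of_int (v (N - k)) - of_int x * \<theta> ^ k\<bar> \<le> F * (2 * (1 + \<bar>\<theta>\<bar>) ^ k)" if k: "k \<le> N" for k
    proof -
      have "\<eta> ^ N * \<theta> ^ k = \<eta> ^ (N - k)"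
      proof -
        have "\<eta> ^ N = \<eta> ^ (N - k) * \<eta> ^ k" using k by (simp flip: power_add)
        then show ?thesis using \<theta> by (simp add: \<eta>_def field_simps)
      qed
      then have "of_int (v (N - k)) - of_int x * \<theta> ^ k =
          (of_int (v (N - k)) - of_int (v 0) * \<eta> ^ (N - k)) - (of_int (v N) - of_int (v 0) * \<eta> ^ N) * \<theta> ^ k"
        by (simp add: x_def algebra_simps)
      also have "\<bar>\<dots>\<bar> \<le> F + F * \<bar>\<theta>\<bar> ^ k"
      proof -
        have "\<bar>(of_int (v N) - of_int (v 0) * \<eta> ^ N) * \<theta> ^ k\<bar> \<le> F * \<bar>\<theta>\<bar> ^ k"
          unfolding abs_mult power_abs using err[of N] by (intro mult_right_mono) (auto simp: F_def)
        then show ?thesis using err[of "N - k"] unfolding F_def by linarith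
      qed
      also have "\<dots> = F * (1 + \<bar>\<theta>\<bar> ^ k)" by (simp add: algebra_simps)
      \<comment> \<open>This weaker form lets the sum over \<open>k\<close> close up again by the
        binomial theorem.\<close>
      also have "\<dots> \<le> F * (2 * (1 + \<bar>\<theta>\<bar>) ^ k)"
      proof (intro mult_left_mono F0)
        have "1 \<le> (1 + \<bar>\<theta>\<bar>) ^ k" by (intro one_le_power) auto
        moreover have "\<bar>\<theta>\<bar> ^ k \<le> (1 + \<bar>\<theta>\<bar>) ^ k" by (intro power_mono) auto
        ultimately show "1 + \<bar>\<theta>\<bar> ^ k \<le> 2 * (1 + \<bar>\<theta>\<bar>) ^ k" by linarith
      qed
      finally show ?thesis .
    qed
    have yerr: "\<bar>\<zeta> ^ i * of_int x - of_int (y i)\<bar> \<le> \<epsilon>" if i: "i \<in> {1..N}" for i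
    proof -
      have "\<zeta> ^ i = (\<theta> + of_int a) ^ i" by (simp add: \<theta>_def)
      also have "\<dots> = (\<Sum>k\<le>i. of_nat (i choose k) * \<theta> ^ k * of_int a ^ (i - k))"
        by (rule binomial_ring)
      finally have "\<zeta> ^ i * of_int x - of_int (y i) =
          (\<Sum>k\<le>i. of_nat (i choose k) * (of_int x * \<theta> ^ k - of_int (v (N - k))) * of_int a ^ (i - k))"
        by (simp add: y_def sum_distrib_right sum_distrib_left right_diff_distrib left_diff_distrib sum_subtractf mult_ac)
      also have "\<bar>\<dots>\<bar> \<le> (\<Sum>k\<le>i. \<bar>of_nat (i choose k) * (of_int x * \<theta> ^ k - of_int (v (N - k))) * of_int a ^ (i - k)\<bar>)"
        by (rule sum_abs)
      also have "\<dots> \<le> (\<Sum>k\<le>i. of_nat (i choose k) * (F * (2 * (1 + \<bar>\<theta>\<bar>) ^ k)) * \<bar>of_int a\<bar> ^ (i - k))"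
      proof (intro sum_mono)
        fix k assume k: "k \<in> {..i}"
        then have "k \<le> N" using i by auto
        then show "\<bar>of_nat (i choose k) * (of_int x * \<theta> ^ k - of_int (v (N - k))) * of_int a ^ (i - k)\<bar>
            \<le> of_nat (i choose k) * (F * (2 * (1 + \<bar>\<theta>\<bar>) ^ k)) * \<bar>of_int a\<bar> ^ (i - k)"
          using uerr[of k] unfolding abs_mult power_abs
          by (intro mult_right_mono mult_mono) (auto simp: abs_minus_commute)
      qed
      also have "\<dots> = 2 * F * ((1 + \<bar>\<theta>\<bar>) + \<bar>of_int a\<bar>) ^ i"
        unfolding binomial_ring by (simp add: sum_distrib_left mult_ac)
      also have "\<dots> \<le> 2 * F * ((1 + \<bar>\<theta>\<bar>) + \<bar>of_int a\<bar>) ^ N"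
        using i F0 by (intro mult_left_mono power_increasing) auto
      also have "\<dots> = 2 * L * F" by (simp add: L_def add_ac)
      also have "\<dots> \<le> \<epsilon>" by (rule K1E)
      finally show ?thesis .
    qed
    have F1: "2 * F < 1"
    proof -
      have "2 * F \<le> L * (2 * F)" using L1 F0 by (simp add: mult_le_cancel_right1)
      then show ?thesis using K1E \<epsilon>(2) by (simp add: mult_ac)
    qed
    have v01: "1 \<le> \<bar>real_of_int (v 0)\<bar>" using v(1) by (simp flip: of_int_abs)
    \<comment> \<open>If \<open>v N = 0\<close>, then \<open>\<bar>\<eta>\<bar> ^ N \<le> F\<close>
      because \<open>v 0\<close> is a nonzero integer; hence \<open>1 \<le> L * F\<close>, against
      \<open>2 * L * F \<le> \<epsilon> < 1\<close>.\<close>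
    have "x \<noteq> 0"
    proof
      assume "x = 0"
      then have "\<bar>of_int (v 0) * \<eta> ^ N\<bar> \<le> F" using err[of N] by (simp add: x_def F_def)
      moreover have "1 * \<bar>\<eta>\<bar> ^ N \<le> \<bar>of_int (v 0)\<bar> * \<bar>\<eta>\<bar> ^ N"
        using v01 by (intro mult_right_mono) auto
      ultimately have "\<bar>\<eta>\<bar> ^ N \<le> F" by (simp add: abs_mult power_abs)
      then have "1 \<le> F * \<bar>\<theta>\<bar> ^ N" using \<theta> by (simp add: \<eta>_def field_simps)
      also have "\<dots> \<le> F * L" unfolding L_def using F0 by (intro mult_left_mono power_mono) auto
      finally have "1 \<le> L * F" by (simp add: mult.commute)
      then show False using K1E \<epsilon>(2) by simp
    qed
    moreover have "of_int \<bar>x\<bar> \<le> K * (real B ^ (n - 1) * of_int (height P) ^ (N - n + 1))"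
    proof -
      have "\<bar>of_int x\<bar> \<le> \<bar>of_int (v 0) * \<eta> ^ N\<bar> + F" using err[of N] by (simp add: x_def F_def)
      \<comment> \<open>The error \<open>F\<close> is below 1 and is absorbed by
        \<open>\<bar>v 0\<bar> \<ge> 1\<close>.\<close>
      also have "\<dots> \<le> \<bar>of_int (v 0)\<bar> * \<bar>\<eta>\<bar> ^ N + \<bar>of_int (v 0)\<bar> * 1"
        using F1 F0 v01 by (simp add: abs_mult power_abs)
      also have "\<dots> = \<bar>of_int (v 0)\<bar> * (\<bar>\<eta>\<bar> ^ N + 1)" by (simp add: algebra_simps)
      also have "\<dots> \<le> (real B ^ (n - 1) * (D * H) ^ (N - n + 1)) * (2 * (\<bar>\<eta>\<bar> + 1) ^ N)"
      proof (intro mult_mono)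
        have "\<bar>real_of_int (q 0)\<bar> ^ (N - n + 1) \<le> (D * H) ^ (N - n + 1)"
          using qH[of 0] by (intro power_mono) auto
        then have "real B ^ (n - 1) * \<bar>real_of_int (q 0)\<bar> ^ (N - n + 1) \<le> real B ^ (n - 1) * (D * H) ^ (N - n + 1)"
          by (intro mult_left_mono) auto
        then show "\<bar>real_of_int (v 0)\<bar> \<le> real B ^ (n - 1) * (D * H) ^ (N - n + 1)" using v0 by linarith
        have "1 \<le> (\<bar>\<eta>\<bar> + 1) ^ N" by (intro one_le_power) auto
        moreover have "\<bar>\<eta>\<bar> ^ N \<le> (\<bar>\<eta>\<bar> + 1) ^ N" by (intro power_mono) auto
        ultimately show "\<bar>\<eta>\<bar> ^ N + 1 \<le> 2 * (\<bar>\<eta>\<bar> + 1) ^ N" by linarith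
      qed (use D H1 in auto)
      also have "\<dots> = K2 * (real B ^ (n - 1) * H ^ (N - n + 1))"
        by (simp add: K2_def power_mult_distrib mult_ac)
      also have "\<dots> \<le> K * (real B ^ (n - 1) * H ^ (N - n + 1))"
        using K1_1 H1 by (intro mult_right_mono) (auto simp: K_def)
      finally show ?thesis by (simp add: H_def)
    qed
    ultimately show "\<exists>(x::int) (y::nat \<Rightarrow> int). 1 \<le> \<bar>x\<bar> \<and>
        of_int \<bar>x\<bar> \<le> K * (real B ^ (n - 1) * of_int (height P) ^ (N - n + 1)) \<and>
        (\<forall>i\<in>{1..N}. \<bar>\<zeta> ^ i * of_int x - of_int (y i)\<bar> \<le> \<epsilon>)"
      using yerr by (intro exI[of _ x] exI[of _ y]) auto
  qed
qed

text \<open>Taking \<open>B\<close> near \<open>H powr \<beta>\<close> balances the two error terms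
  \<open>1 / B\<close> and \<open>B ^ (n - 1) * H ^ (N - n) * H powr (- w)\<close>. Then
  \<open>x\<close> has size \<open>H powr \<xi>\<close> and the errors have size
  \<open>H powr (- \<beta>)\<close>, giving the exponent \<open>\<beta> / \<xi>\<close>. The
  hypothesis on \<open>w\<close> says that \<open>\<beta>\<close> is positive.\<close>

lemma lambda_exp_ge:
  fixes \<zeta> w :: real and n N :: nat
  assumes n: "1 \<le> n" "n \<le> N" and w: "real N - real n < w"
    and inf: "infinite {P :: int poly. degree P \<le> n \<and> 0 < \<bar>poly (map_poly real_of_int P) \<zeta>\<bar> \<and>
                 \<bar>poly (map_poly real_of_int P) \<zeta>\<bar> \<le> real_of_int (height P) powr (- w)}"
      (is "infinite ?S")
  shows "ereal ((w + real n - real N) / (w * (real n - 1) + real N)) \<le> lambda_exp N \<zeta>"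
proof -
  \<comment> \<open>These \<open>n + 1\<close> consecutive integers all exceed
    \<open>\<zeta>\<close>, so that \<open>\<zeta> - a\<close> never vanishes.\<close>
  define A where "A = (\<lambda>i. \<lfloor>\<zeta>\<rfloor> + 1 + int i) ` {..n}"
  have A: "finite A" "card A = Suc n"
    by (auto simp: A_def card_image inj_on_def)
  have A_ne: "\<zeta> \<noteq> of_int a" if "a \<in> A" for a
    using that by (auto simp: A_def) linarith
  obtain C0 :: int where C0: "C0 \<ge> 0"
    "\<And>P M i. degree P \<le> n \<Longrightarrow> (\<forall>a\<in>A. \<bar>poly P a\<bar> \<le> M) \<Longrightarrow> \<bar>coeff P i\<bar> \<le> C0 * M"
    using coeff_bound_from_values[OF A(2)] by metis
  define C where "C = real_of_int C0 + 1"
  have C: "0 < C" using C0 by (simp add: C_def)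
  have "\<exists>a\<in>A. real_of_int (height P) \<le> C * \<bar>of_int (poly P a)\<bar>" if P: "degree P \<le> n" for P
  proof -
    define M where "M = Max ((\<lambda>a. \<bar>poly P a\<bar>) ` A)"
    have "M \<in> (\<lambda>a. \<bar>poly P a\<bar>) ` A" unfolding M_def using A by (intro Max_in) auto
    then obtain a where a: "a \<in> A" "M = \<bar>poly P a\<bar>" by auto
    have "\<forall>a\<in>A. \<bar>poly P a\<bar> \<le> M" unfolding M_def using A by (intro ballI Max_ge) auto
    then have "height P \<le> C0 * M" using C0(2)[OF P] by (simp add: height_le_iff)
    then have "real_of_int (height P) \<le> of_int (C0 * M)" by (simp only: of_int_le_iff)
    also have "\<dots> \<le> C * \<bar>of_int (poly P a)\<bar>" by (simp add: C_def a algebra_simps)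
    finally show ?thesis using a by blast
  qed
  \<comment> \<open>Each polynomial has a good node, and there are finitely many nodes, so one node
    serves infinitely many polynomials.\<close>
  then have "?S \<subseteq> (\<Union>a\<in>A. {P\<in>?S. real_of_int (height P) \<le> C * \<bar>of_int (poly P a)\<bar>})"
    by blast
  with inf A(1) obtain a where a: "a \<in> A"
    "infinite {P\<in>?S. real_of_int (height P) \<le> C * \<bar>of_int (poly P a)\<bar>}" (is "infinite ?T")
    by (meson finite_UN_I finite_subset)
  have large: "\<exists>P\<in>?T. M < height P" for M
  proof (rule ccontr)
    assume "\<not> ?thesis"
    then have "?T \<subseteq> {P. degree P \<le> n \<and> height P \<le> M}" by (auto simp: not_less)
    with a(2) finite_bounded_height finite_subset show False by blast
  qed
  obtain K where K: "1 \<le> K"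
    "\<And>P B \<epsilon>. degree P \<le> n \<Longrightarrow> P \<noteq> 0 \<Longrightarrow> of_int (height P) \<le> C * \<bar>of_int (poly P a)\<bar> \<Longrightarrow> 1 \<le> B \<Longrightarrow>
      \<epsilon> = K * (1 / real B + real B ^ (n - 1) * of_int (height P) ^ (N - n) * \<bar>poly (map_poly real_of_int P) \<zeta>\<bar>) \<Longrightarrow>
      \<epsilon> < 1 \<Longrightarrow>
      \<exists>(x::int) (y::nat \<Rightarrow> int). 1 \<le> \<bar>x\<bar> \<and>
        of_int \<bar>x\<bar> \<le> K * (real B ^ (n - 1) * of_int (height P) ^ (N - n + 1)) \<and>
        (\<forall>i\<in>{1..N}. \<bar>\<zeta> ^ i * of_int x - of_int (y i)\<bar> \<le> \<epsilon>)"
    using simultaneous_approximation_from_polynomial[OF n A_ne[OF a(1)] C] by blast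
  define \<beta> where "\<beta> = (w + real n - real N) / real n"
  define \<xi> where "\<xi> = (w * (real n - 1) + real N) / real n"
  have w0: "0 < w" using w n by simp
  have \<beta>: "0 < \<beta>" using w n by (simp add: \<beta>_def)
  have \<xi>: "0 < \<xi>" unfolding \<xi>_def using w0 n by (intro divide_pos_pos add_nonneg_pos) auto
  have eq1: "\<beta> * (real n - 1) + (real N - real n + 1) = \<xi>"
    using n by (simp add: \<beta>_def \<xi>_def field_simps)
  have eq2: "\<beta> * (real n - 1) + (real N - real n) - w = - \<beta>"
    using n by (simp add: \<beta>_def field_simps)
  define K1 where "K1 = K * 2 ^ (n - 1)"
  define K2 where "K2 = K * (1 + 2 ^ (n - 1))"
  have K1: "0 < K1" and K2: "0 < K2" using K(1) by (auto simp: K1_def K2_def add_pos_nonneg)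
  have approx: "\<exists>(x::int) (y::nat \<Rightarrow> int). 1 \<le> \<bar>x\<bar> \<and> of_int \<bar>x\<bar> \<le> K1 * H powr \<xi> \<and>
        (\<forall>i\<in>{1..N}. \<bar>\<zeta> ^ i * of_int x - of_int (y i)\<bar> \<le> K2 * H powr (- \<beta>))"
    if P: "P \<in> ?T" and H: "H = real_of_int (height P)" and small: "K2 * H powr (- \<beta>) < 1" for P H
  proof -
    have Pnz: "P \<noteq> 0" using P by auto
    have H1: "1 \<le> H" using height_ge_1[OF Pnz] H by simp
    define B where "B = nat \<lceil>H powr \<beta>\<rceil>"
    have Hb: "1 \<le> H powr \<beta>" using H1 \<beta> by (simp add: ge_one_powr_ge_zero)
    have B: "H powr \<beta> \<le> real B" "real B \<le> 2 * H powr \<beta>" "1 \<le> B"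
      using Hb unfolding B_def by linarith+
    have Bp: "real B ^ (n - 1) \<le> 2 ^ (n - 1) * H powr (\<beta> * (real n - 1))"
    proof -
      have "real B ^ (n - 1) \<le> (2 * H powr \<beta>) ^ (n - 1)" using B by (intro power_mono) auto
      also have "\<dots> = 2 ^ (n - 1) * H powr (\<beta> * (real n - 1))"
        using H1 n by (simp add: power_mult_distrib powr_powr flip: powr_realpow)
      finally show ?thesis .
    qed
    have Hp: "H ^ k = H powr real k" for k using H1 by (simp add: powr_realpow)
    define \<epsilon> where "\<epsilon> = K * (1 / real B + real B ^ (n - 1) * H ^ (N - n) * \<bar>poly (map_poly real_of_int P) \<zeta>\<bar>)"
    have "1 / real B \<le> H powr (- \<beta>)"
      unfolding powr_minus_divide by (intro divide_left_mono mult_pos_pos) (use B Hb in linarith)+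
    moreover have "real B ^ (n - 1) * H ^ (N - n) * \<bar>poly (map_poly real_of_int P) \<zeta>\<bar> \<le> 2 ^ (n - 1) * H powr (- \<beta>)"
    proof -
      have "real B ^ (n - 1) * H ^ (N - n) * \<bar>poly (map_poly real_of_int P) \<zeta>\<bar> \<le>
          (2 ^ (n - 1) * H powr (\<beta> * (real n - 1))) * H ^ (N - n) * H powr (- w)"
        using P H H1 Bp by (intro mult_mono) auto
      also have "\<dots> = 2 ^ (n - 1) * H powr (\<beta> * (real n - 1) + (real N - real n) - w)"
        using n by (simp add: Hp powr_add powr_diff powr_minus field_simps)
      finally show ?thesis by (simp add: eq2)
    qed
    ultimately have "\<epsilon> \<le> K * (H powr (- \<beta>) + 2 ^ (n - 1) * H powr (- \<beta>))"
      unfolding \<epsilon>_def using K(1) by (intro mult_left_mono add_mono) auto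
    also have "\<dots> = K2 * H powr (- \<beta>)" by (simp add: K2_def algebra_simps)
    finally have \<epsilon>: "\<epsilon> \<le> K2 * H powr (- \<beta>)" .
    with small have "\<epsilon> < 1" by simp
    have "K * (real B ^ (n - 1) * H ^ (N - n + 1)) \<le> K * ((2 ^ (n - 1) * H powr (\<beta> * (real n - 1))) * H ^ (N - n + 1))"
      using K(1) Bp H1 by (intro mult_left_mono mult_right_mono) auto
    also have "\<dots> = K1 * H powr (\<beta> * (real n - 1) + (real N - real n + 1))"
      using n H1 by (simp add: Hp K1_def powr_add del: power_Suc)
    finally have X: "K * (real B ^ (n - 1) * H ^ (N - n + 1)) \<le> K1 * H powr \<xi>"
      by (simp only: eq1)
    obtain x :: int and y :: "nat \<Rightarrow> int" where xy: "1 \<le> \<bar>x\<bar>"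
        "of_int \<bar>x\<bar> \<le> K * (real B ^ (n - 1) * of_int (height P) ^ (N - n + 1))"
        "\<forall>i\<in>{1..N}. \<bar>\<zeta> ^ i * of_int x - of_int (y i)\<bar> \<le> \<epsilon>"
      using K(2)[OF _ Pnz _ B(3) _ \<open>\<epsilon> < 1\<close>] P unfolding \<epsilon>_def H by blast
    show ?thesis
      using xy X \<epsilon> unfolding H[symmetric] by (intro exI[of _ x] exI[of _ y]) (auto intro: order_trans)
  qed
  \<comment> \<open>The strict inequality leaves a positive power of \<open>H\<close> to absorb the
    constants \<open>K1\<close> and \<open>K2\<close>; the parameter \<open>X\<close> is
    \<open>K1 * H powr \<xi>\<close>, which is unbounded.\<close>
  have *: "ereal l \<le> lambda_exp N \<zeta>" if l: "l < \<beta> / \<xi>" for l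
  proof -
    have lx: "l * \<xi> < \<beta>" using l \<xi> by (simp add: field_simps)
    have "eventually (\<lambda>H::real. K2 * H powr (- \<beta>) < 1) at_top"
      using \<beta> by real_asymp
    moreover have "eventually (\<lambda>H::real. K2 * H powr (- \<beta>) \<le> (K1 * H powr \<xi>) powr (- l)) at_top"
    proof -
      have "filterlim (\<lambda>H::real. H powr (\<beta> - l * \<xi>)) at_top at_top" using lx by real_asymp
      then have "eventually (\<lambda>H::real. K2 * K1 powr l \<le> H powr (\<beta> - l * \<xi>)) at_top"
        by (simp add: filterlim_at_top)
      with eventually_gt_at_top[of 0] show ?thesis
      proof eventually_elim
        case (elim H)
        then show ?case using K1
          by (simp add: powr_mult powr_powr powr_minus powr_diff field_simps)
      qed
    qed
    moreover have "filterlim (\<lambda>H::real. K1 * H powr \<xi>) at_top at_top"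
      using K1 \<xi> by real_asymp
    ultimately have ev: "eventually (\<lambda>H::real. K2 * H powr (- \<beta>) < 1 \<and>
        K2 * H powr (- \<beta>) \<le> (K1 * H powr \<xi>) powr (- l) \<and> X0 \<le> K1 * H powr \<xi>) at_top" for X0
      by (simp add: filterlim_at_top eventually_conj_iff)
    have "\<exists>\<^sub>F X :: real in at_top. \<exists>(x :: int) (y :: nat \<Rightarrow> int).
       1 \<le> \<bar>x\<bar> \<and> real_of_int \<bar>x\<bar> \<le> X \<and>
       (\<forall>i\<in>{1..N}. \<bar>\<zeta> ^ i * real_of_int x - real_of_int (y i)\<bar> \<le> X powr (- l))"
      unfolding frequently_def eventually_at_top_linorder
    proof (rule notI, elim exE)
      fix X0 assume X0: "\<forall>X\<ge>X0. \<not> (\<exists>(x :: int) (y :: nat \<Rightarrow> int).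
       1 \<le> \<bar>x\<bar> \<and> real_of_int \<bar>x\<bar> \<le> X \<and>
       (\<forall>i\<in>{1..N}. \<bar>\<zeta> ^ i * real_of_int x - real_of_int (y i)\<bar> \<le> X powr (- l)))"
      obtain H0 where H0: "\<And>H. H0 \<le> H \<Longrightarrow> K2 * H powr (- \<beta>) < 1 \<and>
        K2 * H powr (- \<beta>) \<le> (K1 * H powr \<xi>) powr (- l) \<and> X0 \<le> K1 * H powr \<xi>"
        using ev[of X0] unfolding eventually_at_top_linorder by blast
      obtain P where P: "P \<in> ?T" "\<lceil>H0\<rceil> < height P" using large by blast
      define H where "H = real_of_int (height P)"
      have "H0 \<le> H" using P(2) unfolding H_def by linarith
      note H = H0[OF this]
      obtain x :: int and y :: "nat \<Rightarrow> int" where "1 \<le> \<bar>x\<bar>" "of_int \<bar>x\<bar> \<le> K1 * H powr \<xi>"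
          "\<forall>i\<in>{1..N}. \<bar>\<zeta> ^ i * of_int x - of_int (y i)\<bar> \<le> K2 * H powr (- \<beta>)"
        using approx[OF P(1) H_def] H by blast
      with H X0 show False by (meson order_trans)
    qed
    then show ?thesis unfolding lambda_exp_def by (intro Sup_upper) blast
  qed
  have "ereal (\<beta> / \<xi>) \<le> lambda_exp N \<zeta>"
  proof (rule dense_le)
    fix z :: ereal assume z: "z < ereal (\<beta> / \<xi>)"
    then show "z \<le> lambda_exp N \<zeta>" using * by (cases z) auto
  qed
  also have "\<beta> / \<xi> = (w + real n - real N) / (w * (real n - 1) + real N)"
    using n by (simp add: \<beta>_def \<xi>_def)
  finally show ?thesis .
qed

section \<open>Dirichlet's lower bound for \<open>w_exp\<close>\<close>

text \<open>Pigeonhole over the \<open>(Q + 1) ^ (n + 1)\<close> coefficient vectors with entries in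
  \<open>0, ..., Q\<close>: two of them have nearly equal values at \<open>\<zeta>\<close>, and
  their difference is \<open>P\<close>.\<close>

lemma dirichlet_polynomial:
  fixes \<zeta> :: real and n Q :: nat
  assumes n: "1 \<le> n" and Q: "2 \<le> Q"
  shows "\<exists>P. P \<noteq> 0 \<and> degree P \<le> n \<and> height P \<le> int Q \<and>
           \<bar>poly (map_poly real_of_int P) \<zeta>\<bar> \<le> 4 * (\<Sum>k\<le>n. \<bar>\<zeta>\<bar> ^ k) / real Q ^ n"
proof -
  define L where "L = (\<Sum>k\<le>n. \<bar>\<zeta>\<bar> ^ k)"
  have "\<bar>\<zeta>\<bar> ^ 0 \<le> L" unfolding L_def by (rule member_le_sum) auto
  then have L: "0 < L" by simp
  \<comment> \<open>Scaling by \<open>s\<close> brings all values into an interval of length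
    \<open>Q ^ (n + 1) / 2\<close>, to be cut into unit cells.\<close>
  define s where "s = real Q ^ n / (4 * L)"
  have s: "0 < s" using Q L by (simp add: s_def)
  define F where "F = PiE {..n} (\<lambda>_. {0..int Q})"
  define g where "g = (\<lambda>f::nat \<Rightarrow> int. \<Sum>k\<le>n. of_int (f k) * \<zeta> ^ k)"
  define R where "R = real (Q ^ (n + 1))"
  define D where "D = {\<lfloor>- R / 4\<rfloor>..\<lfloor>R / 4\<rfloor>}"
  have FD: "(\<lambda>f. \<lfloor>s * g f\<rfloor>) ` F \<subseteq> D"
  proof (rule image_subsetI)
    fix f assume f: "f \<in> F"
    have "\<bar>g f\<bar> \<le> (\<Sum>k\<le>n. \<bar>of_int (f k) * \<zeta> ^ k\<bar>)" unfolding g_def by (rule sum_abs)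
    also have "\<dots> \<le> (\<Sum>k\<le>n. real Q * \<bar>\<zeta>\<bar> ^ k)"
    proof (rule sum_mono)
      fix k assume "k \<in> {..n}"
      then have "f k \<in> {0..int Q}" using f unfolding F_def by (rule PiE_mem[rotated])
      then have "\<bar>real_of_int (f k)\<bar> \<le> real Q" by auto
      then show "\<bar>of_int (f k) * \<zeta> ^ k\<bar> \<le> real Q * \<bar>\<zeta>\<bar> ^ k"
        unfolding abs_mult power_abs by (intro mult_right_mono) auto
    qed
    also have "\<dots> = real Q * L" by (simp add: L_def sum_distrib_left)
    finally have "s * \<bar>g f\<bar> \<le> s * (real Q * L)" using s by (intro mult_left_mono) auto
    also have "\<dots> = R / 4" using L by (simp add: s_def R_def field_simps)
    finally have "\<bar>s * g f\<bar> \<le> R / 4" using s by (simp add: abs_mult)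
    then show "\<lfloor>s * g f\<rfloor> \<in> D" unfolding D_def by (auto intro!: floor_mono)
  qed
  have "2 ^ 2 \<le> Q ^ (n + 1)"
    using n Q by (intro order_trans[OF power_mono power_increasing]) auto
  then have R4: "4 \<le> R" unfolding R_def using of_nat_mono[of 4 "Q ^ (n + 1)", where ?'a = real] by simp
  \<comment> \<open>There are fewer than \<open>R / 2 + 2\<close> cells, and
    \<open>R / 2 + 2 \<le> R\<close> since \<open>4 \<le> R\<close>.\<close>
  have "real (card D) < R + 1"
    using R4 unfolding D_def by simp linarith
  also have "R + 1 \<le> real (card F)"
  proof -
    have "Q ^ (n + 1) < (Q + 1) ^ (n + 1)" by (intro power_strict_mono) auto
    moreover have "card F = (Q + 1) ^ (n + 1)"
      by (simp add: F_def card_PiE nat_add_distrib)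
    ultimately show ?thesis unfolding R_def by linarith
  qed
  finally have "card D < card F" by simp
  then have "\<not> inj_on (\<lambda>f. \<lfloor>s * g f\<rfloor>) F"
    using card_inj_on_le[OF _ FD] by (auto simp: D_def)
  then obtain f h where fh: "f \<in> F" "h \<in> F" "f \<noteq> h" "\<lfloor>s * g f\<rfloor> = \<lfloor>s * g h\<rfloor>"
    by (auto simp: inj_on_def)
  define P where "P = (\<Sum>k\<le>n. monom (f k - h k) k)"
  have cP: "coeff P k = (if k \<le> n then f k - h k else 0)" for k
    by (simp add: P_def coeff_sum)
  have deg: "degree P \<le> n" by (rule degree_le) (simp add: cP)
  have "P \<noteq> 0"
  proof
    assume "P = 0"
    then have "f k = h k" if "k \<le> n" for k using cP[of k] that by simp
    then have "f = h" using fh(1,2) unfolding F_def by (intro PiE_ext) auto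
    with fh show False by simp
  qed
  moreover have "height P \<le> int Q"
    unfolding height_le_iff cP
  proof
    fix k
    have "f k \<in> {0..int Q}" "h k \<in> {0..int Q}" if "k \<le> n"
      using fh(1,2) that unfolding F_def by auto
    then show "\<bar>if k \<le> n then f k - h k else 0\<bar> \<le> int Q" by auto
  qed
  moreover have "\<bar>poly (map_poly real_of_int P) \<zeta>\<bar> \<le> 4 * L / real Q ^ n"
  proof -
    have "poly (map_poly real_of_int P) \<zeta> = g f - g h"
      unfolding poly_of_int_conv_sum[OF deg] g_def
      by (simp add: cP left_diff_distrib sum_subtractf)
    moreover have "\<bar>s * g f - s * g h\<bar> < 1" using fh(4) by linarith
    then have "s * \<bar>g f - g h\<bar> < 1" using s by (simp add: abs_mult flip: right_diff_distrib)
    then have "\<bar>g f - g h\<bar> < 1 / s" using s by (simp add: field_simps)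
    moreover have "1 / s = 4 * L / real Q ^ n" by (simp add: s_def)
    ultimately show ?thesis by simp
  qed
  ultimately show ?thesis using deg unfolding L_def by blast
qed

lemma poly_of_int_nonzero_if_transcendental:
  assumes "\<not> algebraic (\<zeta> :: real)" "P \<noteq> 0"
  shows "poly (map_poly real_of_int P) \<zeta> \<noteq> 0"
proof
  assume "poly (map_poly real_of_int P) \<zeta> = 0"
  moreover have "map_poly real_of_int P \<noteq> 0" using assms(2) by (simp add: map_poly_eq_0_iff)
  ultimately have "algebraic \<zeta>"
    unfolding algebraic_def by (intro exI[of _ "map_poly real_of_int P"]) (auto simp: coeff_map_poly)
  with assms(1) show False by simp
qed

text \<open>Finitely many solutions for some \<open>w < n\<close> would have values bounded away
  from 0, whereas Dirichlet's polynomials take arbitrarily small values, nonzero by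
  transcendence.\<close>

lemma w_exp_ge:
  fixes \<zeta> :: real
  assumes tr: "\<not> algebraic \<zeta>" and n: "1 \<le> n"
  shows "ereal (real n) \<le> w_exp n \<zeta>"
proof -
  have main: "ereal w \<le> w_exp n \<zeta>" if w: "0 \<le> w" "w < real n" for w
  proof -
    let ?S = "{P :: int poly. degree P \<le> n \<and> 0 < \<bar>poly (map_poly real_of_int P) \<zeta>\<bar> \<and>
                 \<bar>poly (map_poly real_of_int P) \<zeta>\<bar> \<le> real_of_int (height P) powr (- w)}"
    have "infinite ?S"
    proof
      assume fin: "finite ?S"
      \<comment> \<open>The inserted 1 keeps the minimum meaningful when there is no solution at
        all.\<close>
      define m where "m = Min (insert 1 ((\<lambda>P. \<bar>poly (map_poly real_of_int P) \<zeta>\<bar>) ` ?S))"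
      have m: "0 < m" unfolding m_def using fin by (subst Min_gr_iff) auto
      have m_le: "m \<le> \<bar>poly (map_poly real_of_int P) \<zeta>\<bar>" if "P \<in> ?S" for P
        unfolding m_def using fin that by (intro Min_le) auto
      define L where "L = 4 * (\<Sum>k\<le>n. \<bar>\<zeta>\<bar> ^ k)"
      have "filterlim (\<lambda>Q::real. Q powr (real n - w)) at_top at_top" using w by real_asymp
      then have "eventually (\<lambda>Q::real. L \<le> Q powr (real n - w)) at_top"
        by (simp add: filterlim_at_top)
      moreover have "filterlim (\<lambda>Q::real. m * Q powr real n) at_top at_top" using m n by real_asymp
      then have "eventually (\<lambda>Q::real. L < m * Q powr real n) at_top"
        by (simp add: filterlim_at_top_dense)
      ultimately have "eventually (\<lambda>Q::real. L \<le> Q powr (real n - w) \<and> L < m * Q powr real n \<and> 2 \<le> Q) at_top"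
        using eventually_ge_at_top[of "2::real"] by eventually_elim auto
      then have "eventually (\<lambda>Q::nat. L \<le> real Q powr (real n - w) \<and> L < m * real Q powr real n \<and> 2 \<le> real Q) sequentially"
        by (rule eventually_compose_filterlim[OF _ filterlim_real_sequentially])
      \<comment> \<open>The first condition turns \<open>L / Q ^ n\<close> into at most
        \<open>Q powr (- w)\<close>; the second pushes it below \<open>m\<close>.\<close>
      then obtain Q :: nat where Q: "L \<le> real Q powr (real n - w)" "L < m * real Q powr real n" "2 \<le> real Q"
        unfolding eventually_sequentially by blast
      obtain P where P: "P \<noteq> 0" "degree P \<le> n" "height P \<le> int Q"
        "\<bar>poly (map_poly real_of_int P) \<zeta>\<bar> \<le> L / real Q ^ n"
        using dirichlet_polynomial[of n Q \<zeta>] n Q(3) unfolding L_def by auto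
      have Qn: "real Q ^ n = real Q powr real n" using Q(3) by (simp add: powr_realpow)
      have "L / real Q ^ n \<le> real Q powr (- w)"
        unfolding Qn using Q by (simp add: powr_diff powr_minus field_simps)
      also have "\<dots> \<le> real_of_int (height P) powr (- w)"
        using P(3) w height_ge_1[OF P(1)] by (intro powr_mono2') auto
      finally have "P \<in> ?S"
        using P poly_of_int_nonzero_if_transcendental[OF tr P(1)] by auto
      from m_le[OF this] P(4) have "m \<le> L / real Q ^ n" by simp
      moreover have "L / real Q ^ n < m" unfolding Qn using Q by (simp add: field_simps)
      ultimately show False by simp
    qed
    then show ?thesis unfolding w_exp_def by (intro Sup_upper) blast
  qed
  show ?thesis
  proof (rule dense_le)
    fix z :: ereal assume z: "z < ereal (real n)"
    show "z \<le> w_exp n \<zeta>"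
    proof (cases z)
      case (real r)
      have "z \<le> ereal (max 0 r)" using real by simp
      also have "\<dots> \<le> w_exp n \<zeta>" using z real n by (intro main) auto
      finally show ?thesis .
    qed (use z in auto)
  qed
qed

text \<open>This makes the optimal ratio \<open>t = (w + 1) / 2\<close> at least 1, as the
  requirement \<open>n \<le> N\<close> demands.\<close>

lemma one_le_w_lower:
  assumes "\<not> algebraic \<zeta>"
  shows "1 \<le> w_lower \<zeta>"
  unfolding w_lower_def
proof (rule Liminf_bounded)
  show "eventually (\<lambda>n. 1 \<le> w_exp n \<zeta> / ereal (real n)) sequentially"
    using eventually_ge_at_top[of 1]
  proof eventually_elim
    case (elim n)
    then show ?case using w_exp_ge[OF assms, of n] by (simp add: ereal_le_divide_pos)
  qed
qed

section \<open>Passage to the limit with \<open>N / n\<close> tending to \<open>t\<close>\<close>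

text \<open>Solution sets shrink as the exponent grows, because nonzero integer polynomials have
  height at least 1; so every exponent below the supremum qualifies.\<close>

lemma w_exp_gr_imp_infinite:
  assumes "ereal c < w_exp n \<zeta>"
  shows "infinite {P :: int poly. degree P \<le> n \<and> 0 < \<bar>poly (map_poly real_of_int P) \<zeta>\<bar> \<and>
           \<bar>poly (map_poly real_of_int P) \<zeta>\<bar> \<le> real_of_int (height P) powr (- c)}" (is "infinite (?S c)")
proof -
  obtain w where w: "c < w" "infinite (?S w)"
    using assms unfolding w_exp_def less_Sup_iff by auto
  have "?S w \<subseteq> ?S c"
  proof
    fix P assume P: "P \<in> ?S w"
    have "P \<noteq> 0" using P by auto
    then have "real_of_int (height P) powr (- w) \<le> real_of_int (height P) powr (- c)"
      using w(1) height_ge_1 by (intro powr_mono) auto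
    with P show "P \<in> ?S c" by auto
  qed
  with w(2) show ?thesis using finite_subset by blast
qed

lemma scaled_lambda_exp_ge:
  assumes "1 \<le> n" "n \<le> N" "real N < (c + 1) * real n" "ereal (c * real n) < w_exp n \<zeta>"
  shows "ereal (real N * (c * real n + real n - real N) / (c * real n * (real n - 1) + real N)) \<le>
         ereal (real N) * lambda_exp N \<zeta>"
proof -
  have "ereal ((c * real n + real n - real N) / (c * real n * (real n - 1) + real N)) \<le> lambda_exp N \<zeta>"
    using assms by (intro lambda_exp_ge w_exp_gr_imp_infinite) (auto simp: algebra_simps)
  from ereal_mult_left_mono[OF this, of "ereal (real N)"] show ?thesis by simp
qed

text \<open>Divide numerator and denominator by the square of \<open>n k\<close>. Both
  \<open>n\<close> and \<open>N\<close> are sequences, so that either one may be chosen in terms of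
  the other.\<close>

lemma scaled_bound_tendsto:
  fixes n N :: "nat \<Rightarrow> nat" and c t :: real
  assumes c: "0 < c" and n: "filterlim n at_top sequentially"
    and t: "(\<lambda>k. real (N k) / real (n k)) \<longlonglongrightarrow> t"
  shows "(\<lambda>k. real (N k) * (c * real (n k) + real (n k) - real (N k)) /
            (c * real (n k) * (real (n k) - 1) + real (N k))) \<longlonglongrightarrow> t * (c + 1 - t) / c"
proof -
  define r where "r = (\<lambda>k. real (N k) / real (n k))"
  define d where "d = (\<lambda>k. 1 / real (n k))"
  have "filterlim (\<lambda>k. real (n k)) at_top sequentially"
    by (rule filterlim_compose[OF filterlim_real_sequentially n])
  then have d: "d \<longlonglongrightarrow> 0"
    unfolding d_def by (intro tendsto_divide_0[OF tendsto_const] filterlim_at_top_imp_at_infinity)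
  have "(\<lambda>k. r k * (c + 1 - r k) / (c * (1 - d k) + r k * d k)) \<longlonglongrightarrow> t * (c + 1 - t) / (c * (1 - 0) + t * 0)"
    using c t unfolding r_def[symmetric] by (intro tendsto_intros d) auto
  moreover have "eventually (\<lambda>k. r k * (c + 1 - r k) / (c * (1 - d k) + r k * d k) =
      real (N k) * (c * real (n k) + real (n k) - real (N k)) /
            (c * real (n k) * (real (n k) - 1) + real (N k))) sequentially"
    using eventually_compose_filterlim[OF eventually_ge_at_top[of 1] n]
  proof eventually_elim
    case (elim k)
    let ?n = "real (n k)" and ?N = "real (N k)"
    have n0: "0 < ?n" using elim by simp
    have "r k * (c + 1 - r k) = ?N * (c * ?n + ?n - ?N) / ?n\<^sup>2"
      using n0 by (simp add: r_def field_simps power2_eq_square)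
    moreover have "c * (1 - d k) + r k * d k = (c * ?n * (?n - 1) + ?N) / ?n\<^sup>2"
      using n0 by (simp add: r_def d_def field_simps power2_eq_square)
    ultimately show ?case using n0 by simp
  qed
  ultimately have "(\<lambda>k. real (N k) * (c * real (n k) + real (n k) - real (N k)) /
      (c * real (n k) * (real (n k) - 1) + real (N k))) \<longlonglongrightarrow> t * (c + 1 - t) / (c * (1 - 0) + t * 0)"
    by (rule Lim_transform_eventually)
  then show ?thesis by simp
qed

lemma floor_ratio_tendsto:
  fixes t :: real
  assumes t: "0 < t"
  shows "(\<lambda>k. real (nat \<lfloor>t * real k\<rfloor>) / real k) \<longlonglongrightarrow> t"
    and "filterlim (\<lambda>k. nat \<lfloor>t * real k\<rfloor>) at_top sequentially"
proof -
  have fl: "t * real k - 1 \<le> real (nat \<lfloor>t * real k\<rfloor>)" "real (nat \<lfloor>t * real k\<rfloor>) \<le> t * real k" for k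
    using t by (auto simp: of_nat_nat)
  show "(\<lambda>k. real (nat \<lfloor>t * real k\<rfloor>) / real k) \<longlonglongrightarrow> t"
  proof (rule tendsto_sandwich)
    show "eventually (\<lambda>k. t - 1 / real k \<le> real (nat \<lfloor>t * real k\<rfloor>) / real k) sequentially"
      using eventually_gt_at_top[of 0]
    proof eventually_elim
      case (elim k)
      have "t - 1 / real k = (t * real k - 1) / real k" using elim by (simp add: field_simps)
      also have "\<dots> \<le> real (nat \<lfloor>t * real k\<rfloor>) / real k"
        by (intro divide_right_mono fl) simp
      finally show ?case .
    qed
    show "eventually (\<lambda>k. real (nat \<lfloor>t * real k\<rfloor>) / real k \<le> t) sequentially"
      using eventually_gt_at_top[of 0]
      by eventually_elim (use fl(2) in \<open>simp add: field_simps\<close>)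
    show "(\<lambda>k. t - 1 / real k) \<longlonglongrightarrow> t" by real_asymp
  qed simp
  have "filterlim (\<lambda>k. t * real k - 1) at_top sequentially" using t by real_asymp
  then have "filterlim (\<lambda>k. real (nat \<lfloor>t * real k\<rfloor>)) at_top sequentially"
    by (rule filterlim_at_top_mono) (use fl in auto)
  then show "filterlim (\<lambda>k. nat \<lfloor>t * real k\<rfloor>) at_top sequentially"
    by (simp add: filterlim_sequentially_iff_filterlim_real)
qed

text \<open>Argued by contraposition with \<open>N\<close> the integer part of \<open>t * n\<close>:
  if \<open>N * lambda_exp N \<zeta>\<close> were eventually below some \<open>s\<close> less than
  the bound, then \<open>w_exp n \<zeta>\<close> could not exceed \<open>c * n\<close> for any large
  \<open>n\<close>, contradicting the limsup.\<close>

lemma lambda_upper_ge: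
  assumes c: "0 < c" "ereal c < w_upper \<zeta>" and t: "1 \<le> t" "t < c + 1"
  shows "ereal (t * (c + 1 - t) / c) \<le> lambda_upper \<zeta>"
proof (rule ccontr)
  define N where "N = (\<lambda>n. nat \<lfloor>t * real n\<rfloor>)"
  assume "\<not> ?thesis"
  then have "lambda_upper \<zeta> < ereal (t * (c + 1 - t) / c)" by simp
  from ereal_dense2[OF this] obtain s
    where s: "lambda_upper \<zeta> < ereal s" "ereal s < ereal (t * (c + 1 - t) / c)" by blast
  have N: "(\<lambda>n. real (N n) / real n) \<longlonglongrightarrow> t" "filterlim N at_top sequentially"
    unfolding N_def using floor_ratio_tendsto[of t] t by auto
  have "eventually (\<lambda>N. ereal (real N) * lambda_exp N \<zeta> < ereal s) sequentially"
    using s(1) unfolding lambda_upper_def by (rule Limsup_lessD)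
  then have ev1: "eventually (\<lambda>n. ereal (real (N n)) * lambda_exp (N n) \<zeta> < ereal s) sequentially"
    by (rule eventually_compose_filterlim[OF _ N(2)])
  have ev2: "eventually (\<lambda>n. s < real (N n) * (c * real n + real n - real (N n)) /
      (c * real n * (real n - 1) + real (N n))) sequentially"
    using scaled_bound_tendsto[OF c(1) filterlim_ident N(1)] s(2) by (intro order_tendstoD(1)) auto
  have "eventually (\<lambda>n. w_exp n \<zeta> / ereal (real n) \<le> ereal c) sequentially"
    using ev1 ev2 eventually_ge_at_top[of 1]
  proof eventually_elim
    case (elim n)
    have "real (N n) \<le> t * real n" unfolding N_def using t by (simp add: of_nat_nat)
    also have "\<dots> < (c + 1) * real n" using t elim by simp
    finally have less: "real (N n) < (c + 1) * real n" .
    have "1 * real n \<le> t * real n" using t by (intro mult_right_mono) auto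
    then have "n \<le> N n" unfolding N_def by (simp add: le_nat_iff le_floor_iff)
    have "\<not> ereal (c * real n) < w_exp n \<zeta>"
    proof
      assume "ereal (c * real n) < w_exp n \<zeta>"
      from scaled_lambda_exp_ge[OF elim(3) \<open>n \<le> N n\<close> less this] elim(1)
      have "ereal (real (N n) * (c * real n + real n - real (N n)) /
          (c * real n * (real n - 1) + real (N n))) < ereal s" by (rule le_less_trans)
      with elim(2) show False by simp
    qed
    then show ?case using elim by (simp add: not_less ereal_divide_le_pos mult.commute)
  qed
  then have "w_upper \<zeta> \<le> ereal c" unfolding w_upper_def by (rule Limsup_bounded)
  with c(2) show False by simp
qed

text \<open>A liminf requires a bound for every large \<open>N\<close>, so here \<open>n\<close> is
  derived from \<open>N\<close> as the integer part of \<open>N / t\<close>; the hypothesis on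
  \<open>w_lower\<close> provides good polynomials for every large \<open>n\<close>.\<close>

lemma lambda_lower_ge:
  assumes c: "0 < c" "ereal c < w_lower \<zeta>" and t: "1 \<le> t" "t < c + 1"
  shows "ereal (t * (c + 1 - t) / c) \<le> lambda_lower \<zeta>"
proof -
  define n where "n = (\<lambda>N. nat \<lfloor>1 / t * real N\<rfloor>)"
  have n: "(\<lambda>N. real (n N) / real N) \<longlonglongrightarrow> 1 / t" "filterlim n at_top sequentially"
    unfolding n_def using floor_ratio_tendsto[of "1 / t"] t by auto
  have ratio: "(\<lambda>N. real N / real (n N)) \<longlonglongrightarrow> t"
    using tendsto_inverse[OF n(1)] t by (simp add: inverse_eq_divide)
  have "eventually (\<lambda>n. ereal c < w_exp n \<zeta> / ereal (real n)) sequentially"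
    using c(2) unfolding w_lower_def by (rule less_LiminfD)
  then have ev1: "eventually (\<lambda>N. ereal c < w_exp (n N) \<zeta> / ereal (real (n N))) sequentially"
    by (rule eventually_compose_filterlim[OF _ n(2)])
  have ev2: "eventually (\<lambda>N. 1 \<le> n N) sequentially"
    by (rule eventually_compose_filterlim[OF eventually_ge_at_top n(2)])
  have ev3: "eventually (\<lambda>N. real N / real (n N) < c + 1) sequentially"
    using ratio t by (intro order_tendstoD(2)) auto
  let ?f = "\<lambda>N. real N * (c * real (n N) + real (n N) - real N) / (c * real (n N) * (real (n N) - 1) + real N)"
  have "eventually (\<lambda>N. ereal (?f N) \<le> ereal (real N) * lambda_exp N \<zeta>) sequentially"
    using ev1 ev2 ev3
  proof eventually_elim
    case (elim N)
    have "real (n N) \<le> 1 / t * real N" unfolding n_def using t by (simp add: of_nat_nat)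
    also have "\<dots> \<le> real N" using t by (simp add: field_simps mult_le_cancel_right1)
    finally have "n N \<le> N" by simp
    moreover have "real N < (c + 1) * real (n N)" using elim by (simp add: field_simps)
    moreover have "ereal (c * real (n N)) < w_exp (n N) \<zeta>"
      using elim by (simp add: ereal_less_divide_pos mult.commute)
    ultimately show ?case using elim by (intro scaled_lambda_exp_ge)
  qed
  then have "liminf (\<lambda>N. ereal (?f N)) \<le> lambda_lower \<zeta>"
    unfolding lambda_lower_def by (rule Liminf_mono)
  moreover have "liminf (\<lambda>N. ereal (?f N)) = ereal (t * (c + 1 - t) / c)"
    using scaled_bound_tendsto[OF c(1) n(2) ratio]
    by (intro lim_imp_Liminf trivial_limit_sequentially tendsto_ereal)
  ultimately show ?thesis by simp
qed

section \<open>Choice of the optimal ratio \<open>t\<close>\<close>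

text \<open>For finite \<open>W = r\<close> the maximum of \<open>t * (r + 1 - t) / r\<close> is
  attained at \<open>t = (r + 1) / 2\<close>. Since \<open>bound\<close> covers only
  \<open>c < r\<close>, this \<open>t\<close> is fixed and \<open>c\<close> tends to
  \<open>r\<close> from the left.\<close>

lemma spectrum_bound_le:
  fixes W \<Lambda> :: ereal
  assumes W: "1 \<le> W"
    and bound: "\<And>c t. 0 < c \<Longrightarrow> ereal c < W \<Longrightarrow> 1 \<le> t \<Longrightarrow> t < c + 1 \<Longrightarrow> ereal (t * (c + 1 - t) / c) \<le> \<Lambda>"
  shows "spectrum_bound W \<le> \<Lambda>"
proof (cases W)
  case PInf
  have "\<Lambda> = \<infinity>"
  proof (rule ereal_top)
    fix B :: real
    \<comment> \<open>With \<open>c = 2 * t\<close> the bound equals \<open>(t + 1) / 2\<close>,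
      which exceeds any given \<open>B\<close>.\<close>
    define t where "t = max 1 (2 * B)"
    have t: "1 \<le> t" "2 * B \<le> t" by (auto simp: t_def)
    have "t * (2 * t + 1 - t) / (2 * t) = (t + 1) / 2" using t by (simp add: field_simps)
    then have "B \<le> t * (2 * t + 1 - t) / (2 * t)" using t by simp
    moreover have "ereal (t * (2 * t + 1 - t) / (2 * t)) \<le> \<Lambda>"
      using t PInf by (intro bound) auto
    ultimately show "ereal B \<le> \<Lambda>" by (meson ereal_less_eq(3) order_trans)
  qed
  then show ?thesis by simp
next
  case (real r)
  have r: "1 \<le> r" using W real by simp
  define t where "t = (r + 1) / 2"
  have "((\<lambda>c. t * (c + 1 - t) / c) \<longlongrightarrow> t * (r + 1 - t) / r) (at_left r)"
    using r by (intro tendsto_intros) auto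
  then have lim: "((\<lambda>c. ereal (t * (c + 1 - t) / c)) \<longlongrightarrow> ereal (t * (r + 1 - t) / r)) (at_left r)"
    by (rule tendsto_ereal)
  \<comment> \<open>The left end \<open>t - 1\<close> ensures \<open>t < c + 1\<close>.\<close>
  have "eventually (\<lambda>c. c \<in> {max 0 (t - 1)<..<r}) (at_left r)"
    using r by (intro eventually_at_left_real) (auto simp: t_def)
  then have "eventually (\<lambda>c. ereal (t * (c + 1 - t) / c) \<le> \<Lambda>) (at_left r)"
  proof eventually_elim
    case (elim c)
    then show ?case using r real by (intro bound) (auto simp: t_def)
  qed
  then have "ereal (t * (r + 1 - t) / r) \<le> \<Lambda>"
    by (rule tendsto_upperbound[OF lim]) simp
  also have "t * (r + 1 - t) / r = (r + 1)\<^sup>2 / (4 * r)"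
    using r by (simp add: t_def field_simps power2_eq_square)
  also have "ereal \<dots> = spectrum_bound W"
    using r real by (simp add: spectrum_bound_def one_ereal_def)
  finally show ?thesis .
qed (use W in auto)

theorem theorem3p7:
  shows "(\<forall>\<zeta> :: real. \<not> algebraic \<zeta> \<longrightarrow>
            spectrum_bound (w_upper \<zeta>) \<le> lambda_upper \<zeta> \<and>
            spectrum_bound (w_lower \<zeta>) \<le> lambda_lower \<zeta>) \<and>
         (\<forall>\<zeta> :: real. T_number \<zeta> \<longrightarrow>
            limsup (\<lambda>n. ereal (real n) * lambda_exp n \<zeta>) = \<infinity>)"
proof (intro conjI allI impI)
  fix \<zeta> :: real assume tr: "\<not> algebraic \<zeta>"
  have "w_lower \<zeta> \<le> w_upper \<zeta>"
    unfolding w_lower_def w_upper_def by (rule Liminf_le_Limsup) simp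
  then show "spectrum_bound (w_upper \<zeta>) \<le> lambda_upper \<zeta>"
    using one_le_w_lower[OF tr] by (intro spectrum_bound_le lambda_upper_ge) auto
  show "spectrum_bound (w_lower \<zeta>) \<le> lambda_lower \<zeta>"
    using one_le_w_lower[OF tr] by (intro spectrum_bound_le lambda_lower_ge) auto
next
  fix \<zeta> :: real assume "T_number \<zeta>"
  then have W: "w_upper \<zeta> = \<infinity>" by (simp add: T_number_def w_upper_def)
  \<comment> \<open>Here \<open>w_upper \<zeta> = \<infinity>\<close> itself supplies the condition
    \<open>1 \<le> w_upper \<zeta>\<close>.\<close>
  then have "spectrum_bound (w_upper \<zeta>) \<le> lambda_upper \<zeta>"
    by (intro spectrum_bound_le lambda_upper_ge) auto
  then show "limsup (\<lambda>n. ereal (real n) * lambda_exp n \<zeta>) = \<infinity>"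
    by (simp add: W spectrum_bound_def lambda_upper_def)
qed

end
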